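(* For every $n\ge1$, the number of permutations $\sigma\in\mathfrak{S}_n$ such that $\mathbf{S}(\mathbf{i}(\mathbf{S}(\sigma)))=12\cdots n$ equals the Baxter number $b_n=\frac{2}{n(n+1)^2}\sum_{k=1}^n\binom{n+1}{k-1}\binom{n+1}{k}\binom{n+1}{k+1}$ (equivalently, the number of permutations of size $n$ avoiding the dashed patterns $2\text{-}41\text{-}3$ and $3\text{-}14\text{-}2$).
   Context: $\mathfrak{S}_n$ is the set of permutations of $\{1,\dots,n\}$, written as words. The stack sorting operator $\mathbf{S}$ is defined on words of distinct integers recursively by $\mathbf{S}(\varepsilon)=\varepsilon$ and $\mathbf{S}(LmR)=\mathbf{S}(L)\,\mathbf{S}(R)\,m$, where $m$ is the maximum letter of $LmR$. $\mathbf{i}(\pi)$ denotes the inverse permutation of $\pi$. A permutation $\sigma$ contains the dashed pattern $2\text{-}41\text{-}3$ if there are indices $i<j<j+1<k$ with $\sigma_{j+1}<\sigma_i<\sigma_k<\sigma_j$, and contains $3\text{-}14\text{-}2$ if there are indices $i<j<j+1<k$ with $\sigma_j<\sigma_k<\sigma_i<\sigma_{j+1}$; avoiding means not containing. *)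

theory Defs
  imports Complex_Main "HOL-Combinatorics.Multiset_Permutations"
begin

text \<open>
  Words are lists, and a permutation of size \<open>n\<close> is a word in
  \<^term>\<open>permutations_of_set {1..n::nat}\<close>, i.e. a duplicate-free list with set of letters
  \<open>{1..n}\<close>.
\<close>

(* The nonempty word w is split as L m R at the (for distinct letters, unique) occurrence of its
   maximum m; see the lemma stack_sort_decomp for the usual form of the recursion. *)
function stack_sort :: "'a::linorder list \<Rightarrow> 'a list" where
  "stack_sort w =
     (if w = [] then []
      else let m = Max (set w);
               L = takeWhile (\<lambda>x. x \<noteq> m) w;
               R = tl (dropWhile (\<lambda>x. x \<noteq> m) w)
           in stack_sort L @ stack_sort R @ [m])"
  by auto
termination
proof (relation "measure length", goal_cases)
  case 1
  show ?case by simp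
next
  case (2 w m L)
  have "m \<in> set w"
    unfolding 2(2) by (rule Max_in) (use 2(1) in simp_all)
  then have "L \<noteq> w"
    unfolding 2(3) takeWhile_eq_all_conv by blast
  moreover have "L @ dropWhile (\<lambda>x. x \<noteq> m) w = w"
    unfolding 2(3) by (rule takeWhile_dropWhile_id)
  ultimately have "length L < length w"
    by (metis append_Nil2 length_append length_greater_0_conv less_add_same_cancel1)
  then show ?case
    unfolding in_measure .
next
  case (3 w m L R)
  have "length R \<le> length w - 1"
    unfolding 3(4) length_tl by (intro diff_le_mono length_dropWhile_le)
  also have "\<dots> < length w"
    using 3(1) by (cases w) simp_all
  finally show ?case
    unfolding in_measure .
qed

declare stack_sort.simps [simp del]

lemma stack_sort_Nil [simp]: "stack_sort [] = []"
  by (simp add: stack_sort.simps)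

lemma stack_sort_decomp:
  assumes "\<And>x. x \<in> set L \<union> set R \<Longrightarrow> x < m"
  shows "stack_sort (L @ m # R) = stack_sort L @ stack_sort R @ [m]"
proof -
  have max: "Max (set (L @ m # R)) = m"
    by (rule Max_eqI) (use assms in \<open>auto intro: less_imp_le\<close>)
  have L: "\<forall>x\<in>set L. x \<noteq> m"
    using assms by fastforce
  have "takeWhile (\<lambda>x. x \<noteq> m) (L @ m # R) = L"
    using L by simp
  moreover have "dropWhile (\<lambda>x. x \<noteq> m) (L @ m # R) = m # R"
    using L by simp
  ultimately show ?thesis
    by (subst stack_sort.simps) (simp add: max Let_def del: set_append)
qed

(* Positions are 1-based; outside {1..length w} the function is the identity, so that it permutes
   {1..length w} whenever w is a permutation, and inv is its inverse. *)
definition perm_of_word :: "nat list \<Rightarrow> nat \<Rightarrow> nat" where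
  "perm_of_word w i = (if i \<in> {1..length w} then w ! (i - 1) else i)"

definition inverse_word :: "nat list \<Rightarrow> nat list" where
  "inverse_word w = map (inv (perm_of_word w)) [1..<Suc (length w)]"

definition contains_2_41_3 :: "'a::linorder list \<Rightarrow> bool" where
  "contains_2_41_3 w \<longleftrightarrow>
     (\<exists>i j k. i < j \<and> j + 1 < k \<and> k < length w \<and>
        w ! (j + 1) < w ! i \<and> w ! i < w ! k \<and> w ! k < w ! j)"

definition contains_3_14_2 :: "'a::linorder list \<Rightarrow> bool" where
  "contains_3_14_2 w \<longleftrightarrow>
     (\<exists>i j k. i < j \<and> j + 1 < k \<and> k < length w \<and>
        w ! j < w ! k \<and> w ! k < w ! i \<and> w ! i < w ! (j + 1))"

definition baxter_number :: "nat \<Rightarrow> real" where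
  "baxter_number n =
     2 / (real n * (real n + 1) ^ 2) *
     (\<Sum>k=1..n. real ((n + 1) choose (k - 1)) * real ((n + 1) choose k) * real ((n + 1) choose (k + 1)))"

end

theory Submission
  imports Defs "HOL-Computational_Algebra.Formal_Laurent_Series"
begin

text \<open>
  The permutations in question are those avoiding 3412 and 3-4-21; they grow by inserting a new
  minimum, while Baxter permutations grow by inserting a new maximum next to a left-to-right or
  right-to-left maximum. Both generating trees carry two integer labels and are solved by the kernel
  method. Weight a node by a Laurent monomial in its labels and antisymmetrise the weight over a copy of
  $S_3$: the boundary terms of the recursion cancel, and passing to the next level multiplies the total
  weight by the same kernel \<open>(x+y)(y+z)(z+x)/(xyz)\<close> for both trees. All but one of the six terms of
  an antisymmetrised weight are invisible to a suitable coefficient extraction, under which every node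
  contributes \<open>1\<close>; so both counts are signed sums of coefficients of powers of the kernel, which
  count walks on the triangular lattice. The two signed sums agree because these walk counts are
  invariant under the dihedral group and under infinitesimal rotations, and the sum for Baxter
  permutations is a sum of \<open>3 \<times> 3\<close> determinants of binomial coefficients.
\<close>

section \<open>The kernel identities of the two generating trees\<close>

text \<open>No label-preserving correspondence between the two trees is used; they are compared only
  after their labels have been eliminated. A succession rule applied to a monomial weight produces
  two geometric sums, and each of them leaves a boundary term that depends on the variables in a
  degenerate way. The parametrisations are arranged so that the multiplier is invariant under the
  whole group while each boundary term is fixed by some transposition; the alternating sum then
  removes both, and no functional equation has to be solved. The price is five unwanted terms per
  node. For Baxter permutations they are Laurent polynomials and drop out by the signs of their
  exponents. For the other tree they have denominators such as \<open>x + y\<close>, so the answer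
  depends on the direction of expansion. This forces Laurent series in \<alpha> over Laurent series
  in \<gamma>, and a coefficient chosen so that the surviving term gives the same value for all
  labels. The root is the one-letter word with labels \<open>(0, 0)\<close>, so size
  \<open>m + 1\<close> corresponds to the \<open>m\<close>-th power of the kernel.\<close>

text \<open>
  The node \<open>(a, k)\<close> has weight $X^a Y^k$ with $X = (x+y+z)/x$ and $Y = (x+y+z)/(x+y)$. The prefactor makes
  the two boundary terms in \<open>sis_term_children\<close> symmetric in \<open>x, y\<close> and in \<open>y, z\<close>, respectively.
\<close>

definition sis_term :: "'a::field \<Rightarrow> 'a \<Rightarrow> 'a \<Rightarrow> nat \<Rightarrow> nat \<Rightarrow> 'a" where
  "sis_term x y z a k =
     (x + y + z) * z / (x\<^sup>2 * (x + y)) * ((x + y + z) / x) ^ a * ((x + y + z) / (x + y)) ^ k"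

definition hex_kernel :: "'a::field \<Rightarrow> 'a \<Rightarrow> 'a \<Rightarrow> 'a" where
  "hex_kernel x y z = (x + y) * (y + z) * (z + x) / (x * y * z)"

lemma sis_term_children:
  fixes x y z :: "'a::field"
  assumes nz: "x \<noteq> 0" "y \<noteq> 0" "z \<noteq> 0" "x + y \<noteq> 0" "x + y + z \<noteq> 0"
  shows "(\<Sum>p\<le>Suc a. sis_term x y z p (Suc a - p + k)) + (\<Sum>j<k. sis_term x y z a j) =
           hex_kernel x y z * sis_term x y z a k
           - z / (x * y) * ((x + y + z) / (x + y)) ^ (a + k + 2)
           - (x + y + z) / x\<^sup>2 * ((x + y + z) / x) ^ a"
proof -
  define s where "s = x + y + z"
  define A where "A = s / x"
  define B where "B = s / (x + y)"
  define M where "M = s * z / (x\<^sup>2 * (x + y))"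
  have s: "s \<noteq> 0" using nz by (simp add: s_def)
  \<comment> \<open>The geometric sums over the two families of children close up after
    multiplication by \<open>A - B\<close> and by \<open>B - 1\<close>. The prefactor
    \<open>M\<close> is a multiple of both, so one weight serves both sums.\<close>
  have M1: "M = z / (x * y) * (A - B)"
    using nz s unfolding M_def A_def B_def by (simp add: field_simps power2_eq_square)
  have M2: "M = s / x\<^sup>2 * (B - 1)"
    using nz s unfolding M_def B_def by (simp add: divide_simps) (simp add: s_def algebra_simps)
  \<comment> \<open>The two sums contribute \<open>z / (x * y) * A^2\<close> and
    \<open>s / x^2\<close> to the coefficient of \<open>A^a * B^k\<close>. That together they are a
    symmetric function times \<open>M\<close> rests on
    \<open>(y + z) * (z + x) = z * s + x * y\<close>.\<close>
  have KM: "hex_kernel x y z * M = z / (x * y) * A\<^sup>2 + s / x\<^sup>2"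
  proof -
    have "hex_kernel x y z * M = (y + z) * (z + x) * s / (x ^ 3 * y)"
    proof -
      have "w * (y + z) * (z + x) / (x * y * z) * (s * z / (x\<^sup>2 * w)) = (y + z) * (z + x) * s / (x ^ 3 * y)"
        if "w \<noteq> 0" for w
        using nz that by (simp add: field_simps power2_eq_square power3_eq_cube)
      from this[OF nz(4)] show ?thesis
        unfolding hex_kernel_def M_def .
    qed
    also have "(y + z) * (z + x) = z * s + x * y"
      by (simp add: s_def algebra_simps)
    also have "(z * s + x * y) * s / (x ^ 3 * y) = z / (x * y) * A\<^sup>2 + s / x\<^sup>2"
      using nz unfolding A_def by (simp add: field_simps power2_eq_square power3_eq_cube)
    finally show ?thesis .
  qed
  have t: "sis_term x y z i j = M * A ^ i * B ^ j" for i j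
    by (simp add: sis_term_def M_def A_def B_def s_def)
  have P: "(A - B) * (\<Sum>p\<le>Suc a. A ^ p * B ^ (Suc a - p)) = A ^ (a + 2) - B ^ (a + 2)"
    using diff_power_eq_sum[of A "Suc a" B] by (simp add: lessThan_Suc_atMost)
  have Q: "(B - 1) * (\<Sum>j<k. B ^ j) = B ^ k - 1"
    by (rule power_diff_1_eq [symmetric])
  have "(\<Sum>p\<le>Suc a. sis_term x y z p (Suc a - p + k)) =
      z / (x * y) * B ^ k * ((A - B) * (\<Sum>p\<le>Suc a. A ^ p * B ^ (Suc a - p)))"
    by (simp only: t power_add sum_distrib_left M1 mult_ac)
  also have "\<dots> = z / (x * y) * A\<^sup>2 * (A ^ a * B ^ k) - z / (x * y) * B ^ (a + k + 2)"
    unfolding P by (simp add: power_add power2_eq_square algebra_simps)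
  finally have 1: "(\<Sum>p\<le>Suc a. sis_term x y z p (Suc a - p + k)) = \<dots>" .
  have "(\<Sum>j<k. sis_term x y z a j) = s / x\<^sup>2 * A ^ a * ((B - 1) * (\<Sum>j<k. B ^ j))"
    by (simp add: t sum_distrib_left M2 algebra_simps)
  also have "\<dots> = s / x\<^sup>2 * (A ^ a * B ^ k) - s / x\<^sup>2 * A ^ a"
    unfolding Q by (simp only: right_diff_distrib mult.assoc mult_1_right)
  finally have 2: "(\<Sum>j<k. sis_term x y z a j) = \<dots>" .
  have "hex_kernel x y z * sis_term x y z a k = (z / (x * y) * A\<^sup>2 + s / x\<^sup>2) * (A ^ a * B ^ k)"
    unfolding KM [symmetric] by (simp add: t algebra_simps)
  then show ?thesis
    unfolding 1 2 by (simp add: A_def B_def flip: s_def) (simp add: ring_distribs)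
qed

definition sis_orbit :: "'a::field \<Rightarrow> 'a \<Rightarrow> 'a \<Rightarrow> nat \<Rightarrow> nat \<Rightarrow> 'a" where
  "sis_orbit x y z a k =
     sis_term x y z a k - sis_term x z y a k + sis_term y z x a k
     - sis_term y x z a k + sis_term z x y a k - sis_term z y x a k"

text \<open>The six orders carry their permutation signs. \<open>R1\<close> is unchanged when its
  first two arguments are exchanged and \<open>R2\<close> depends on the first argument only, so
  each cancels between two orders that differ by a transposition; the symmetric kernel factors
  out.\<close>

lemma sis_orbit_children:
  fixes x y z :: "'a::field"
  assumes nz: "x \<noteq> 0" "y \<noteq> 0" "z \<noteq> 0" "x + y \<noteq> 0" "x + z \<noteq> 0" "y + z \<noteq> 0" "x + y + z \<noteq> 0"
  shows "(\<Sum>p\<le>Suc a. sis_orbit x y z p (Suc a - p + k)) + (\<Sum>j<k. sis_orbit x y z a j) =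
           hex_kernel x y z * sis_orbit x y z a k"
proof -
  define s where "s = x + y + z"
  define R1 where "R1 = (\<lambda>x y z :: 'a. z / (x * y) * (s / (x + y)) ^ (a + k + 2))"
  define R2 where "R2 = (\<lambda>x :: 'a. s / x\<^sup>2 * (s / x) ^ a)"
  define C where "C = (\<lambda>x y z :: 'a. (\<Sum>p\<le>Suc a. sis_term x y z p (Suc a - p + k)) + (\<Sum>j<k. sis_term x y z a j))"
  have C: "C p q r = hex_kernel x y z * sis_term p q r a k - R1 p q r - R2 p"
    if "p \<noteq> 0" "q \<noteq> 0" "r \<noteq> 0" "p + q \<noteq> 0" "p + q + r = s" "hex_kernel p q r = hex_kernel x y z" for p q r
    using sis_term_children[of p q r a k] that nz(7)
    unfolding C_def R1_def R2_def by (simp only: s_def not_False_eq_True)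
  have k: "hex_kernel x z y = hex_kernel x y z" "hex_kernel y z x = hex_kernel x y z" "hex_kernel y x z = hex_kernel x y z"
    "hex_kernel z x y = hex_kernel x y z" "hex_kernel z y x = hex_kernel x y z"
    by (simp_all add: hex_kernel_def mult_ac add_ac)
  have R1: "R1 p q r = R1 q p r" for p q r
    by (simp add: R1_def mult.commute add.commute)
  have nz': "y + x \<noteq> 0" "z + x \<noteq> 0" "z + y \<noteq> 0"
    using nz(4-6) by (metis add.commute)+
  have s: "x + y + z = s" "x + z + y = s" "y + z + x = s" "y + x + z = s" "z + x + y = s" "z + y + x = s"
    by (simp_all add: s_def algebra_simps)
  have "(\<Sum>p\<le>Suc a. sis_orbit x y z p (Suc a - p + k)) + (\<Sum>j<k. sis_orbit x y z a j) =
      C x y z - C x z y + C y z x - C y x z + C z x y - C z y x"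
    unfolding C_def by (simp add: sis_orbit_def sum.distrib sum_subtractf del: sum.atMost_Suc)
  also have "\<dots> = hex_kernel x y z * sis_orbit x y z a k"
    unfolding C[OF nz(1,2,3,4) s(1) refl] C[OF nz(1,3,2,5) s(2) k(1)] C[OF nz(2,3,1,6) s(3) k(2)]
      C[OF nz(2,1,3) nz'(1) s(4) k(3)] C[OF nz(3,1,2) nz'(2) s(5) k(4)] C[OF nz(3,2,1) nz'(3) s(6) k(5)]
      sis_orbit_def ring_distribs
    using R1[of x y z] R1[of y z x] R1[of z x y] by simp
  finally show ?thesis .
qed

text \<open>
  The orbit of \<open>(u, v)\<close> under the involutions \<open>u \<mapsto> v/u\<close> and \<open>v \<mapsto> u/v\<close>, which preserve
  $(1+u)(1+v)(u+v)/(uv)$.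
\<close>

definition bax_orbit :: "'a::field \<Rightarrow> 'a \<Rightarrow> nat \<Rightarrow> nat \<Rightarrow> 'a" where
  "bax_orbit u v i j = (let t = \<lambda>u v. u * v * (1 + u) ^ i * (1 + v) ^ j in
     t u v - t (v/u) v + t (v/u) (1/u) - t (1/v) (1/u) + t (1/v) (u/v) - t u (u/v))"

text \<open>The factor \<open>u * v\<close> is what the geometric sums in \<open>1 + u\<close> and
  \<open>1 + v\<close> need in order to telescope; each boundary term then contains only one of the
  two variables.\<close>

lemma bax_term_children:
  fixes u v :: "'a::field"
  assumes nz: "u \<noteq> 0" "v \<noteq> 0"
  shows "u * v * (\<Sum>s\<le>i. (1 + u) ^ s * (1 + v) ^ Suc j) + u * v * (\<Sum>s\<le>j. (1 + u) ^ Suc i * (1 + v) ^ s) =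
    (1 + u) * (1 + v) * (u + v) / (u * v) * (u * v * (1 + u) ^ i * (1 + v) ^ j) 
     - v * (1 + v) ^ Suc j - u * (1 + u) ^ Suc i"
proof -
  have g: "x * (\<Sum>s\<le>n. (1 + x) ^ s) = (1 + x) ^ Suc n - 1" for x :: 'a and n
    using power_diff_1_eq[of "1 + x" "Suc n"] by (simp add: lessThan_Suc_atMost)
  have "u * v * (\<Sum>s\<le>i. (1 + u) ^ s * (1 + v) ^ Suc j) = v * (1 + v) ^ Suc j * (u * (\<Sum>s\<le>i. (1 + u) ^ s))"
    by (simp add: sum_distrib_left sum_distrib_right mult_ac)
  moreover have "u * v * (\<Sum>s\<le>j. (1 + u) ^ Suc i * (1 + v) ^ s) = u * (1 + u) ^ Suc i * (v * (\<Sum>s\<le>j. (1 + v) ^ s))"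
    by (simp add: sum_distrib_left sum_distrib_right mult_ac)
  ultimately have "u * v * (\<Sum>s\<le>i. (1 + u) ^ s * (1 + v) ^ Suc j) + u * v * (\<Sum>s\<le>j. (1 + u) ^ Suc i * (1 + v) ^ s) =
      v * (1 + v) ^ Suc j * ((1 + u) ^ Suc i - 1) + u * (1 + u) ^ Suc i * ((1 + v) ^ Suc j - 1)"
    by (simp only: g)
  also have "\<dots> = (1 + u) * (1 + v) * (u + v) * ((1 + u) ^ i * (1 + v) ^ j)
      - v * (1 + v) ^ Suc j - u * (1 + u) ^ Suc i"
    by (simp add: algebra_simps)
  also have "(1 + u) * (1 + v) * (u + v) * ((1 + u) ^ i * (1 + v) ^ j) =
      (1 + u) * (1 + v) * (u + v) / (u * v) * (u * v * (1 + u) ^ i * (1 + v) ^ j)"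
    using nz by simp
  finally show ?thesis .
qed

text \<open>Neighbours in the cycle \<open>(u, v)\<close>, \<open>(v/u, v)\<close>,
  \<open>(v/u, 1/u)\<close>, \<open>(1/v, 1/u)\<close>, \<open>(1/v, u/v)\<close>,
  \<open>(u, u/v)\<close> share alternately their second and their first entry. Each boundary term
  sees one entry and the signs alternate, so everything but the kernel multiple cancels around the
  cycle.\<close>

lemma bax_orbit_children:
  fixes u v :: "'a::field"
  assumes nz: "u \<noteq> 0" "v \<noteq> 0"
  shows "(\<Sum>s\<le>i. bax_orbit u v s (Suc j)) + (\<Sum>s\<le>j. bax_orbit u v (Suc i) s) =
    (1 + u) * (1 + v) * (u + v) / (u * v) * bax_orbit u v i j"
proof -
  define K where "K = (1 + u) * (1 + v) * (u + v) / (u * v)"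
  define t where "t = (\<lambda>i j u v :: 'a. u * v * (1 + u) ^ i * (1 + v) ^ j)"
  have o: "bax_orbit u v i j = t i j u v - t i j (v/u) v + t i j (v/u) (1/u) - t i j (1/v) (1/u)
      + t i j (1/v) (u/v) - t i j u (u/v)" for i j
    by (simp add: bax_orbit_def t_def Let_def)
  have b: "(\<Sum>s\<le>i. t s (Suc j) x y) + (\<Sum>s\<le>j. t (Suc i) s x y) =
      K * t i j x y - y * (1 + y) ^ Suc j - x * (1 + x) ^ Suc i"
    if "x \<noteq> 0" "y \<noteq> 0" "(1 + x) * (1 + y) * (x + y) / (x * y) = K" for x y
    using bax_term_children[OF that(1,2), where i = i and j = j] unfolding that(3)
    by (simp only: t_def sum_distrib_left mult.assoc)
  have "(\<Sum>s\<le>i. bax_orbit u v s (Suc j)) + (\<Sum>s\<le>j. bax_orbit u v (Suc i) s) =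
      ((\<Sum>s\<le>i. t s (Suc j) u v) + (\<Sum>s\<le>j. t (Suc i) s u v))
    - ((\<Sum>s\<le>i. t s (Suc j) (v/u) v) + (\<Sum>s\<le>j. t (Suc i) s (v/u) v))
    + ((\<Sum>s\<le>i. t s (Suc j) (v/u) (1/u)) + (\<Sum>s\<le>j. t (Suc i) s (v/u) (1/u)))
    - ((\<Sum>s\<le>i. t s (Suc j) (1/v) (1/u)) + (\<Sum>s\<le>j. t (Suc i) s (1/v) (1/u)))
    + ((\<Sum>s\<le>i. t s (Suc j) (1/v) (u/v)) + (\<Sum>s\<le>j. t (Suc i) s (1/v) (u/v)))
    - ((\<Sum>s\<le>i. t s (Suc j) u (u/v)) + (\<Sum>s\<le>j. t (Suc i) s u (u/v)))"
    unfolding o by (simp add: sum.distrib sum_subtractf)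
  also have "\<dots> = K * bax_orbit u v i j"
  proof -
    have 1: "(1 + u) * (1 + v) * (u + v) / (u * v) = K"
      by (simp add: K_def)
    have 2: "(1 + v/u) * (1 + v) * (v/u + v) / (v/u * v) = K"
      using nz by (simp add: K_def field_simps)
    have 3: "(1 + v/u) * (1 + 1/u) * (v/u + 1/u) / (v/u * (1/u)) = K"
      using nz by (simp add: K_def field_simps)
    have 4: "(1 + 1/v) * (1 + 1/u) * (1/v + 1/u) / (1/v * (1/u)) = K"
      using nz by (simp add: K_def field_simps)
    have 5: "(1 + 1/v) * (1 + u/v) * (1/v + u/v) / (1/v * (u/v)) = K"
      using nz by (simp add: K_def field_simps)
    have 6: "(1 + u) * (1 + u/v) * (u + u/v) / (u * (u/v)) = K"
      using nz by (simp add: K_def field_simps)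
    have "v/u \<noteq> 0" "u/v \<noteq> 0" "1/u \<noteq> 0" "1/v \<noteq> 0"
      using nz by simp_all
    then show ?thesis
      unfolding b[OF nz 1] b[OF \<open>v/u \<noteq> 0\<close> nz(2) 2] b[OF \<open>v/u \<noteq> 0\<close> \<open>1/u \<noteq> 0\<close> 3]
        b[OF \<open>1/v \<noteq> 0\<close> \<open>1/u \<noteq> 0\<close> 4] b[OF \<open>1/v \<noteq> 0\<close> \<open>u/v \<noteq> 0\<close> 5] b[OF nz(1) \<open>u/v \<noteq> 0\<close> 6]
        o
      by (simp only: ring_distribs) simp
  qed
  finally show ?thesis unfolding K_def .
qed

section \<open>Coefficient extraction in iterated Laurent series\<close>

text \<open>
  The outer variable is \<open>\<alpha>\<close>, so \<open>1/(\<alpha> + \<gamma>)\<close> is expanded in powers of \<open>\<alpha>/\<gamma>\<close>.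
\<close>

type_synonym laurent2 = "real fls fls"

definition al :: laurent2 ("\<alpha>") where "\<alpha> = fls_X"
definition ga :: laurent2 ("\<gamma>") where "\<gamma> = fls_const fls_X"

definition co :: "laurent2 \<Rightarrow> int \<Rightarrow> int \<Rightarrow> real" where
  "co f i j = fls_nth (fls_nth f i) j"

lemma co_simps [simp]:
  "co (f + g) i j = co f i j + co g i j"
  "co (f - g) i j = co f i j - co g i j"
  "co (- f) i j = - co f i j"
  "co 0 i j = 0"
  "co 1 i j = (if i = 0 \<and> j = 0 then 1 else 0)"
  "co (\<alpha> * f) i j = co f (i - 1) j"
  "co (f * \<alpha>) i j = co f (i - 1) j"
  "co (\<gamma> * f) i j = co f i (j - 1)"
  "co (f * \<gamma>) i j = co f i (j - 1)"
  by (simp_all add: co_def al_def ga_def fls_X_times_conv_shift)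

lemma co_sum: "co (\<Sum>x\<in>A. f x) i j = (\<Sum>x\<in>A. co (f x) i j)"
  by (simp add: co_def fls_nth_sum)

lemma al_nonzero [simp]: "\<alpha> \<noteq> 0" and ga_nonzero [simp]: "\<gamma> \<noteq> 0"
  by (simp_all add: al_def ga_def)

lemma co_divide [simp]:
  "co (f / \<alpha>) i j = co f (i + 1) j"
  "co (f / \<gamma>) i j = co f i (j + 1)"
proof -
  have "co (\<alpha> * (f / \<alpha>)) (i + 1) j = co f (i + 1) j" 
    by simp
  then show "co (f / \<alpha>) i j = co f (i + 1) j"
    unfolding co_simps by simp
  have "co (\<gamma> * (f / \<gamma>)) i (j + 1) = co f i (j + 1)"
    by simp
  then show "co (f / \<gamma>) i j = co f i (j + 1)"
    unfolding co_simps by simp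
qed

lemma co_al [simp]: "co \<alpha> i j = (if i = 1 \<and> j = 0 then 1 else 0)"
  and co_ga [simp]: "co \<gamma> i j = (if i = 0 \<and> j = 1 then 1 else 0)"
  using co_simps(6)[of 1 i j] co_simps(8)[of 1 i j] by auto

lemma co_divide_power:
  "co (f / \<alpha> ^ n) i j = co f (i + int n) j"
  "co (f / \<gamma> ^ n) i j = co f i (j + int n)"
proof -
  show "co (f / \<alpha> ^ n) i j = co f (i + int n) j"
  proof (induction n arbitrary: i)
    case (Suc n)
    have "f / \<alpha> ^ Suc n = f / \<alpha> ^ n / \<alpha>" by simp
    then show ?case by (simp only: co_divide Suc.IH) (simp add: algebra_simps)
  qed simp
  show "co (f / \<gamma> ^ n) i j = co f i (j + int n)"
  proof (induction n arbitrary: j)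
    case (Suc n)
    have "f / \<gamma> ^ Suc n = f / \<gamma> ^ n / \<gamma>" by simp
    then show ?case by (simp only: co_divide Suc.IH) (simp add: algebra_simps)
  qed simp
qed

lemma sums_nonzero:
  "1 + \<alpha> \<noteq> 0" "\<alpha> + 1 \<noteq> 0" "1 + \<gamma> \<noteq> 0" "\<gamma> + 1 \<noteq> 0" "\<alpha> + \<gamma> \<noteq> 0" "\<gamma> + \<alpha> \<noteq> 0" "\<alpha> + 1 + \<gamma> \<noteq> 0"
proof -
  have "co (1 + \<alpha>) 1 0 = 1" "co (\<alpha> + 1) 1 0 = 1" "co (1 + \<gamma>) 0 1 = 1" "co (\<gamma> + 1) 0 1 = 1" 
    "co (\<alpha> + \<gamma>) 1 0 = 1" "co (\<gamma> + \<alpha>) 1 0 = 1" "co (\<alpha> + 1 + \<gamma>) 1 0 = 1"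
    by simp_all
  then show "1 + \<alpha> \<noteq> 0" "\<alpha> + 1 \<noteq> 0" "1 + \<gamma> \<noteq> 0" "\<gamma> + 1 \<noteq> 0" "\<alpha> + \<gamma> \<noteq> 0" "\<gamma> + \<alpha> \<noteq> 0" "\<alpha> + 1 + \<gamma> \<noteq> 0"
    by (metis co_simps(4) zero_neq_one)+
qed

lemma co_eq_0_below: obtains N where "\<And>i j. i < N \<Longrightarrow> co f i j = 0"
  by (rule that[of "fls_subdegree f"]) (simp add: co_def)

lemma co_eq_0_below': obtains N where "\<And>j. j < N \<Longrightarrow> co f i j = 0"
  by (rule that[of "fls_subdegree (fls_nth f i)"]) (simp add: co_def)

text \<open>Quotients by two-term sums are known only through a two-term recurrence, which
  determines the coefficients once they vanish far enough down. For the exponent of \<alpha> such a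
  bound is uniform in the exponent of \<gamma>; for the exponent of \<gamma> it depends on that of
  \<alpha>, which is then kept fixed.\<close>

lemma int_induct_from_below:
  fixes P :: "int \<Rightarrow> bool"
  assumes "\<And>i. i < N \<Longrightarrow> P i" and "\<And>i. P (i - 1) \<Longrightarrow> P i"
  shows "P i"
proof (cases "i < N")
  case False
  then have "N - 1 \<le> i" by simp
  then show ?thesis
    by (induction i rule: int_ge_induct) (use assms in \<open>auto simp: assms(2)[of "_ + 1", simplified]\<close>)
qed (use assms in auto)

lemma co_divide_1_plus_al: "co (f / (1 + \<alpha>)) i j = co f i j - co (f / (1 + \<alpha>)) (i - 1) j"
proof -
  have "(1 + \<alpha>) * (f / (1 + \<alpha>)) = f"
    using sums_nonzero by simp
  then have "co f i j = co ((1 + \<alpha>) * (f / (1 + \<alpha>))) i j"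
    by simp
  then show ?thesis
    unfolding distrib_right co_simps mult_1 by simp
qed

lemma co_divide_1_plus_ga: "co (f / (1 + \<gamma>)) i j = co f i j - co (f / (1 + \<gamma>)) i (j - 1)"
proof -
  have "(1 + \<gamma>) * (f / (1 + \<gamma>)) = f"
    using sums_nonzero by simp
  then have "co f i j = co ((1 + \<gamma>) * (f / (1 + \<gamma>))) i j"
    by simp
  then show ?thesis
    unfolding distrib_right co_simps mult_1 by simp
qed

lemma co_divide_al_plus_ga: "co (f / (\<alpha> + \<gamma>)) i j = co f i (j + 1) - co (f / (\<alpha> + \<gamma>)) (i - 1) (j + 1)"
proof -
  have "(\<alpha> + \<gamma>) * (f / (\<alpha> + \<gamma>)) = f"
    using sums_nonzero by simp
  then have "co f i (j + 1) = co ((\<alpha> + \<gamma>) * (f / (\<alpha> + \<gamma>))) i (j + 1)"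
    by simp
  then show ?thesis
    unfolding distrib_right co_simps mult_1 by simp
qed

section \<open>Supports of quotients and of the terms of an orbit\<close>

definition supported :: "(int \<Rightarrow> int \<Rightarrow> bool) \<Rightarrow> laurent2 \<Rightarrow> bool" where
  "supported P f \<longleftrightarrow> (\<forall>i j. \<not> P i j \<longrightarrow> co f i j = 0)"

lemma supportedD: "supported P f \<Longrightarrow> \<not> P i j \<Longrightarrow> co f i j = 0"
  by (simp add: supported_def)

lemma supported_divide_1_plus_al:
  assumes "supported P f" and "\<And>i j. P (i - 1) j \<Longrightarrow> P i j"
  shows "supported P (f / (1 + \<alpha>))"
proof -
  obtain N where N: "\<And>i j. i < N \<Longrightarrow> co (f / (1 + \<alpha>)) i j = 0"
    using co_eq_0_below by blast
  have "\<forall>j. \<not> P i j \<longrightarrow> co (f / (1 + \<alpha>)) i j = 0" for i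
  proof (rule int_induct_from_below[where N = N])
    fix i assume "\<forall>j. \<not> P (i - 1) j \<longrightarrow> co (f / (1 + \<alpha>)) (i - 1) j = 0"
    then show "\<forall>j. \<not> P i j \<longrightarrow> co (f / (1 + \<alpha>)) i j = 0"
      using assms(2)[of i] supportedD[OF assms(1), of i] by (auto simp: co_divide_1_plus_al[of f i])
  qed (simp add: N)
  then show ?thesis by (simp add: supported_def)
qed

lemma supported_divide_1_plus_ga:
  assumes "supported P f" and "\<And>i j. P i (j - 1) \<Longrightarrow> P i j"
  shows "supported P (f / (1 + \<gamma>))"
proof -
  have "\<not> P i j \<longrightarrow> co (f / (1 + \<gamma>)) i j = 0" for i j
  proof -
    obtain N where N: "\<And>j. j < N \<Longrightarrow> co (f / (1 + \<gamma>)) i j = 0"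
      using co_eq_0_below' by blast
    show ?thesis
    proof (rule int_induct_from_below[where N = N])
      fix j assume "\<not> P i (j - 1) \<longrightarrow> co (f / (1 + \<gamma>)) i (j - 1) = 0"
      then show "\<not> P i j \<longrightarrow> co (f / (1 + \<gamma>)) i j = 0"
        using assms by (auto simp: co_divide_1_plus_ga[of f i j] dest: supportedD)
    qed (simp add: N)
  qed
  then show ?thesis by (simp add: supported_def)
qed

text \<open>The recurrence links \<open>(i, j)\<close> to \<open>(i - 1, j + 1)\<close>, so the
  induction runs over \<open>i\<close> with all \<open>j\<close> at once. Two regions occur because
  the division lowers the total degree by one.\<close>

lemma supported_divide_al_plus_ga:
  assumes "supported P f" and "\<And>i j. P i (j + 1) \<Longrightarrow> Q i j"
    and "\<And>i j. Q (i - 1) (j + 1) \<Longrightarrow> Q i j"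
  shows "supported Q (f / (\<alpha> + \<gamma>))"
proof -
  obtain N where N: "\<And>i j. i < N \<Longrightarrow> co (f / (\<alpha> + \<gamma>)) i j = 0"
    using co_eq_0_below by blast
  have "\<forall>j. \<not> Q i j \<longrightarrow> co (f / (\<alpha> + \<gamma>)) i j = 0" for i
  proof (rule int_induct_from_below[where N = N])
    fix i assume *: "\<forall>j. \<not> Q (i - 1) j \<longrightarrow> co (f / (\<alpha> + \<gamma>)) (i - 1) j = 0"
    show "\<forall>j. \<not> Q i j \<longrightarrow> co (f / (\<alpha> + \<gamma>)) i j = 0"
    proof (intro allI impI)
      fix j assume "\<not> Q i j"
      then have "\<not> P i (j + 1)" "\<not> Q (i - 1) (j + 1)"
        using assms(2,3) by blast+
      then show "co (f / (\<alpha> + \<gamma>)) i j = 0"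
        using supportedD[OF assms(1), of i "j + 1"] *[rule_format, of "j + 1"] by (auto simp: co_divide_al_plus_ga[of f i])
    qed
  qed (simp add: N)
  then show ?thesis by (simp add: supported_def)
qed

lemma supported_sis_term:
  assumes "supported P ((x + y + z) * z / (x\<^sup>2 * (x + y)))"
    and "\<And>f. supported P f \<Longrightarrow> supported P (f * (x + y + z) / x)"
    and "\<And>f. supported P f \<Longrightarrow> supported P (f * (x + y + z) / (x + y))"
  shows "supported P (sis_term x y z a k)"
proof -
  have "supported P ((x + y + z) * z / (x\<^sup>2 * (x + y)) * ((x + y + z) / x) ^ a)" for a
  proof (induction a)
    case (Suc a)
    from assms(2)[OF this] show ?case by (simp add: mult_ac)
  qed (use assms(1) in simp)
  then have *: "supported P ((x + y + z) * z / (x\<^sup>2 * (x + y)) * ((x + y + z) / x) ^ a)" .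
  show ?thesis
    unfolding sis_term_def
  proof (induction k)
    case (Suc k)
    from assms(3)[OF this] show ?case by (simp add: mult_ac)
  qed (use * in simp)
qed

text \<open>Total degree excludes this term. Expanding \<open>1 / (\<alpha> + \<gamma>)\<close> in
  powers of \<open>\<alpha> / \<gamma>\<close> respects homogeneity, so the prefactor has only
  degrees at most -2 and the two base fractions only degrees at most 0, whereas
  \<open>(-2, 1)\<close> has degree -1.\<close>

lemma co_sis_term_al_ga_1: "co (sis_term \<alpha> \<gamma> 1 a k) (-2) 1 = 0"
proof -
  have "supported (\<lambda>i j. i + j \<le> -2) (sis_term \<alpha> \<gamma> 1 a k)"
  proof (rule supported_sis_term)
    have "supported (\<lambda>i j. i + j \<le> -1) ((\<alpha> + \<gamma> + 1) / \<alpha> / \<alpha>)"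
      by (auto simp: supported_def simp del: divide_divide_eq_left)
    then have "supported (\<lambda>i j. i + j \<le> -2) ((\<alpha> + \<gamma> + 1) / \<alpha> / \<alpha> / (\<alpha> + \<gamma>))"
      by (rule supported_divide_al_plus_ga) auto
    then show "supported (\<lambda>i j. i + j \<le> -2) ((\<alpha> + \<gamma> + 1) * 1 / (\<alpha>\<^sup>2 * (\<alpha> + \<gamma>)))"
      by (simp add: power2_eq_square)
  next
    fix f assume f: "supported (\<lambda>i j. i + j \<le> -2) f"
    then show "supported (\<lambda>i j. i + j \<le> -2) (f * (\<alpha> + \<gamma> + 1) / \<alpha>)"
      by (auto simp: supported_def distrib_left)
    from f have "supported (\<lambda>i j. i + j \<le> -1) (f * (\<alpha> + \<gamma> + 1))"
      by (auto simp: supported_def distrib_left)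
    then show "supported (\<lambda>i j. i + j \<le> -2) (f * (\<alpha> + \<gamma> + 1) / (\<alpha> + \<gamma>))"
      by (rule supported_divide_al_plus_ga) auto
  qed
  then show ?thesis by (simp add: supported_def)
qed

text \<open>In this term and the next three, \<alpha> enters denominators only through
  \<open>1 + \<alpha>\<close> or \<open>\<gamma> + \<alpha>\<close>, which are expanded in
  nonnegative powers of \<alpha>; hence the exponent -2 cannot occur.\<close>

lemma co_sis_term_1_al_ga: "co (sis_term 1 \<alpha> \<gamma> a k) (-2) 1 = 0"
proof -
  have "supported (\<lambda>i j. i \<ge> 0) (sis_term 1 \<alpha> \<gamma> a k)"
  proof (rule supported_sis_term)
    have "supported (\<lambda>i j. i \<ge> 0) ((1 + \<alpha> + \<gamma>) * \<gamma>)"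
      by (auto simp: supported_def)
    then have "supported (\<lambda>i j. i \<ge> 0) ((1 + \<alpha> + \<gamma>) * \<gamma> / (1 + \<alpha>))"
      by (rule supported_divide_1_plus_al) auto
    then show "supported (\<lambda>i j. i \<ge> 0) ((1 + \<alpha> + \<gamma>) * \<gamma> / (1\<^sup>2 * (1 + \<alpha>)))"
      by simp
  next
    fix f assume "supported (\<lambda>i j. i \<ge> 0) f"
    then have f: "supported (\<lambda>i j. i \<ge> 0) (f * (1 + \<alpha> + \<gamma>))"
      by (auto simp: supported_def distrib_left)
    then show "supported (\<lambda>i j. i \<ge> 0) (f * (1 + \<alpha> + \<gamma>) / 1)"
      by simp
    from f show "supported (\<lambda>i j. i \<ge> 0) (f * (1 + \<alpha> + \<gamma>) / (1 + \<alpha>))"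
      by (rule supported_divide_1_plus_al) auto
  qed
  then show ?thesis by (simp add: supported_def)
qed

lemma co_sis_term_1_ga_al: "co (sis_term 1 \<gamma> \<alpha> a k) (-2) 1 = 0"
proof -
  have "supported (\<lambda>i j. i \<ge> 0) (sis_term 1 \<gamma> \<alpha> a k)"
  proof (rule supported_sis_term)
    have "supported (\<lambda>i j. i \<ge> 0) ((1 + \<gamma> + \<alpha>) * \<alpha>)"
      by (auto simp: supported_def)
    then have "supported (\<lambda>i j. i \<ge> 0) ((1 + \<gamma> + \<alpha>) * \<alpha> / (1 + \<gamma>))"
      by (rule supported_divide_1_plus_ga) auto
    then show "supported (\<lambda>i j. i \<ge> 0) ((1 + \<gamma> + \<alpha>) * \<alpha> / (1\<^sup>2 * (1 + \<gamma>)))"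
      by simp
  next
    fix f assume "supported (\<lambda>i j. i \<ge> 0) f"
    then have f: "supported (\<lambda>i j. i \<ge> 0) (f * (1 + \<gamma> + \<alpha>))"
      by (auto simp: supported_def distrib_left)
    then show "supported (\<lambda>i j. i \<ge> 0) (f * (1 + \<gamma> + \<alpha>) / 1)"
      by simp
    from f show "supported (\<lambda>i j. i \<ge> 0) (f * (1 + \<gamma> + \<alpha>) / (1 + \<gamma>))"
      by (rule supported_divide_1_plus_ga) auto
  qed
  then show ?thesis by (simp add: supported_def)
qed

lemma co_sis_term_ga_1_al: "co (sis_term \<gamma> 1 \<alpha> a k) (-2) 1 = 0"
proof -
  have "supported (\<lambda>i j. i \<ge> 0) (sis_term \<gamma> 1 \<alpha> a k)"
  proof (rule supported_sis_term)
    have "supported (\<lambda>i j. i \<ge> 0) ((\<gamma> + 1 + \<alpha>) * \<alpha> / \<gamma> / \<gamma>)"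
      by (auto simp: supported_def simp del: divide_divide_eq_left)
    then have "supported (\<lambda>i j. i \<ge> 0) ((\<gamma> + 1 + \<alpha>) * \<alpha> / \<gamma> / \<gamma> / (1 + \<gamma>))"
      by (rule supported_divide_1_plus_ga) auto
    then show "supported (\<lambda>i j. i \<ge> 0) ((\<gamma> + 1 + \<alpha>) * \<alpha> / (\<gamma>\<^sup>2 * (\<gamma> + 1)))"
      by (simp add: power2_eq_square add.commute)
  next
    fix f assume "supported (\<lambda>i j. i \<ge> 0) f"
    then have f: "supported (\<lambda>i j. i \<ge> 0) (f * (\<gamma> + 1 + \<alpha>))"
      by (auto simp: supported_def distrib_left)
    then show "supported (\<lambda>i j. i \<ge> 0) (f * (\<gamma> + 1 + \<alpha>) / \<gamma>)"
      by (auto simp: supported_def)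
    from f have "supported (\<lambda>i j. i \<ge> 0) (f * (\<gamma> + 1 + \<alpha>) / (1 + \<gamma>))"
      by (rule supported_divide_1_plus_ga) auto
    then show "supported (\<lambda>i j. i \<ge> 0) (f * (\<gamma> + 1 + \<alpha>) / (\<gamma> + 1))"
      by (simp add: add.commute)
  qed
  then show ?thesis by (simp add: supported_def)
qed

lemma co_sis_term_ga_al_1: "co (sis_term \<gamma> \<alpha> 1 a k) (-2) 1 = 0"
proof -
  have "supported (\<lambda>i j. i \<ge> 0) (sis_term \<gamma> \<alpha> 1 a k)"
  proof (rule supported_sis_term)
    have "supported (\<lambda>i j. i \<ge> 0) ((\<gamma> + \<alpha> + 1) / \<gamma> / \<gamma>)"
      by (auto simp: supported_def simp del: divide_divide_eq_left)
    then have "supported (\<lambda>i j. i \<ge> 0) ((\<gamma> + \<alpha> + 1) / \<gamma> / \<gamma> / (\<alpha> + \<gamma>))"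
      by (rule supported_divide_al_plus_ga) auto
    then show "supported (\<lambda>i j. i \<ge> 0) ((\<gamma> + \<alpha> + 1) * 1 / (\<gamma>\<^sup>2 * (\<gamma> + \<alpha>)))"
      by (simp add: power2_eq_square add.commute)
  next
    fix f assume "supported (\<lambda>i j. i \<ge> 0) f"
    then have f: "supported (\<lambda>i j. i \<ge> 0) (f * (\<gamma> + \<alpha> + 1))"
      by (auto simp: supported_def distrib_left)
    then show "supported (\<lambda>i j. i \<ge> 0) (f * (\<gamma> + \<alpha> + 1) / \<gamma>)"
      by (auto simp: supported_def)
    from f have "supported (\<lambda>i j. i \<ge> 0) (f * (\<gamma> + \<alpha> + 1) / (\<alpha> + \<gamma>))"
      by (rule supported_divide_al_plus_ga) auto
    then show "supported (\<lambda>i j. i \<ge> 0) (f * (\<gamma> + \<alpha> + 1) / (\<gamma> + \<alpha>))"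
      by (simp add: add.commute)
  qed
  then show ?thesis by (simp add: supported_def)
qed

text \<open>Integer lower indices with value 0 below 0 allow Pascal's rule and index shifts without
  side conditions.\<close>

definition binom :: "nat \<Rightarrow> int \<Rightarrow> real" where
  "binom n i = (if i < 0 then 0 else real (n choose nat i))"

lemma binom_0 [simp]: "binom 0 i = (if i = 0 then 1 else 0)"
  by (auto simp: binom_def)

lemma binom_Suc: "binom (Suc n) i = binom n i + binom n (i - 1)"
proof (cases "i \<le> 0")
  case False
  then have "nat i = Suc (nat (i - 1))" by simp
  then show ?thesis using False by (simp add: binom_def)
qed (auto simp: binom_def)


lemma co_1_plus_al_power: "co ((1 + \<alpha>) ^ n) i j = (if j = 0 then binom n i else 0)"
  by (induction n arbitrary: i) (auto simp: distrib_right binom_Suc)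

lemma co_1_plus_al_ga_power: "co ((1 + \<alpha>) ^ m * (1 + \<gamma>) ^ n) i j = binom m i * binom n j"
proof (induction n arbitrary: j)
  case 0
  then show ?case by (simp add: co_1_plus_al_power)
next
  case (Suc n)
  have "(1 + \<alpha>) ^ m * (1 + \<gamma>) ^ Suc n = (1 + \<alpha>) ^ m * (1 + \<gamma>) ^ n + \<gamma> * ((1 + \<alpha>) ^ m * (1 + \<gamma>) ^ n)"
    by (simp add: algebra_simps)
  then show ?case
    by (simp only: co_simps Suc.IH binom_Suc) (simp add: algebra_simps)
qed

text \<open>A comparison to first order in \<gamma>: the series \<open>f\<close> starts at exponent
  1 of \<gamma>, and its coefficient there is the \<gamma>-free part of \<open>h\<close>. A factor
  \<open>\<alpha> + 1 + \<gamma>\<close> of \<open>f\<close> then acts on \<open>h\<close> merely as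
  \<open>\<alpha> + 1\<close>.\<close>

definition leading :: "laurent2 \<Rightarrow> laurent2 \<Rightarrow> bool" where
  "leading f h \<longleftrightarrow> (\<forall>i. (\<forall>j<1. co f i j = 0) \<and> co f i 1 = co h i 0)"

lemma leading_mult_sum: "leading f h \<Longrightarrow> leading (f * (\<alpha> + 1 + \<gamma>)) (h * (\<alpha> + 1))"
  by (simp add: leading_def distrib_left)

lemma leading_divide_al: "leading f h \<Longrightarrow> leading (f / \<alpha>) (h / \<alpha>)"
  by (simp add: leading_def)

lemma leading_divide_1_plus_al:
  assumes "leading f h"
  shows "leading (f / (1 + \<alpha>)) (h / (1 + \<alpha>))"
proof -
  obtain M N where N: "\<And>i j. i < M \<Longrightarrow> co (f / (1 + \<alpha>)) i j = 0" "\<And>i j. i < N \<Longrightarrow> co (h / (1 + \<alpha>)) i j = 0"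
    using co_eq_0_below[of "f / (1 + \<alpha>)"] co_eq_0_below[of "h / (1 + \<alpha>)"] by metis
  have "(\<forall>j<1. co (f / (1 + \<alpha>)) i j = 0) \<and> co (f / (1 + \<alpha>)) i 1 = co (h / (1 + \<alpha>)) i 0" for i
  proof (rule int_induct_from_below[where N = "min M N" and i = i])
    fix i assume "(\<forall>j<1. co (f / (1 + \<alpha>)) (i - 1) j = 0) \<and> co (f / (1 + \<alpha>)) (i - 1) 1 = co (h / (1 + \<alpha>)) (i - 1) 0"
    then show "(\<forall>j<1. co (f / (1 + \<alpha>)) i j = 0) \<and> co (f / (1 + \<alpha>)) i 1 = co (h / (1 + \<alpha>)) i 0"
      using assms by (simp add: leading_def co_divide_1_plus_al[of _ i])
  qed (simp add: N)
  then show ?thesis by (simp add: leading_def)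
qed

text \<open>To lowest order in \<gamma> the base of the exponent \<open>k\<close> becomes 1 and the
  prefactor becomes \<open>\<gamma> / \<alpha>^2\<close>. What remains is the coefficient of
  \<open>\<alpha>^a\<close> in \<open>(1 + \<alpha>)^a\<close>, which is 1 for every
  \<open>a\<close>. This is the origin of the position \<open>(-2, 1)\<close>.\<close>

lemma co_sis_term_al_1_ga: "co (sis_term \<alpha> 1 \<gamma> a k) (-2) 1 = 1"
proof -
  have nz: "\<alpha> + 1 \<noteq> 0" by (rule sums_nonzero)
  have "leading \<gamma> 1"
    by (simp add: leading_def)
  from leading_divide_1_plus_al[OF leading_divide_al[OF leading_divide_al[OF leading_mult_sum[OF this]]]]
  have 0: "leading ((\<alpha> + 1 + \<gamma>) * \<gamma> / (\<alpha>\<^sup>2 * (\<alpha> + 1))) (1 / \<alpha> / \<alpha>)"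
    using nz by (simp add: power2_eq_square mult_ac add.commute)
  have 1: "leading ((\<alpha> + 1 + \<gamma>) * \<gamma> / (\<alpha>\<^sup>2 * (\<alpha> + 1)) * ((\<alpha> + 1 + \<gamma>) / \<alpha>) ^ a)
      ((1 + \<alpha>) ^ a / \<alpha> ^ a / \<alpha> / \<alpha>)"
  proof (induction a)
    case (Suc a)
    from leading_divide_al[OF leading_mult_sum[OF this]] show ?case
      by (simp add: mult_ac add.commute)
  qed (use 0 in simp)
  have "leading (sis_term \<alpha> 1 \<gamma> a k) ((1 + \<alpha>) ^ a / \<alpha> ^ a / \<alpha> / \<alpha>)"
    unfolding sis_term_def
  proof (induction k)
    case (Suc k)
    from leading_divide_1_plus_al[OF leading_mult_sum[OF this]] show ?case
      using nz by (simp add: mult_ac add.commute)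
  qed (use 1 in simp)
  then have "co (sis_term \<alpha> 1 \<gamma> a k) (-2) 1 = co ((1 + \<alpha>) ^ a / \<alpha> ^ a / \<alpha> / \<alpha>) (-2) 0"
    by (simp add: leading_def del: divide_divide_eq_left)
  also have "\<dots> = co ((1 + \<alpha>) ^ a / \<alpha> ^ a) 0 0"
    by (simp del: divide_divide_eq_left)
  also have "\<dots> = co ((1 + \<alpha>) ^ a) (int a) 0"
    by (simp add: co_divide_power)
  also have "\<dots> = 1"
    by (simp add: co_1_plus_al_power binom_def)
  finally show ?thesis .
qed

lemma co_sis_orbit: "co (sis_orbit \<alpha> 1 \<gamma> a k) (-2) 1 = 1"
  by (simp add: sis_orbit_def co_sis_term_1_al_ga co_sis_term_1_ga_al co_sis_term_al_1_ga co_sis_term_al_ga_1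
      co_sis_term_ga_1_al co_sis_term_ga_al_1)

lemma supported_mult_power:
  assumes "supported P f" "\<And>f. supported P f \<Longrightarrow> supported P (f * g)"
  shows "supported P (f * g ^ n)"
proof (induction n)
  case (Suc n)
  from assms(2)[OF this] show ?case by (simp add: mult_ac)
qed (use assms in simp)

text \<open>All six terms are Laurent polynomials. In the first, both exponents are at most -1 and
  the extreme coefficient is 1; the second to fourth contain only positive powers of \<alpha>, the
  last two only positive powers of \<gamma>.\<close>

lemma co_bax_orbit: "co (bax_orbit (1 / \<alpha>) (1 / \<gamma>) i j) (-1) (-1) = 1"
proof -
  note dd = divide_divide_eq_left
  have 1: "co (1 / \<alpha> * (1 / \<gamma>) * (1 + 1 / \<alpha>) ^ i * (1 + 1 / \<gamma>) ^ j) (-1) (-1) = 1"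
  proof -
    have "1 / \<alpha> * (1 / \<gamma>) * (1 + 1 / \<alpha>) ^ i * (1 + 1 / \<gamma>) ^ j =
        (1 + \<alpha>) ^ i * (1 + \<gamma>) ^ j / \<alpha> ^ Suc i / \<gamma> ^ Suc j"
    proof -
      have e: "1 + 1 / \<alpha> = (1 + \<alpha>) / \<alpha>" "1 + 1 / \<gamma> = (1 + \<gamma>) / \<gamma>"
        by (simp_all add: field_simps)
      show ?thesis
        unfolding e by (simp add: power_divide mult_ac)
    qed
    then show ?thesis
      by (simp only: co_divide_power co_1_plus_al_ga_power) (simp add: binom_def)
  qed
  have 2: "supported (\<lambda>i j. i \<ge> 1) (\<alpha> / \<gamma> / \<gamma> * (1 + \<alpha> / \<gamma>) ^ i * (1 + 1 / \<gamma>) ^ j)"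
    by (intro supported_mult_power) (auto simp: supported_def distrib_left simp del: dd)
  have 3: "supported (\<lambda>i j. i \<ge> 1) (\<alpha> * \<alpha> / \<gamma> * (1 + \<alpha> / \<gamma>) ^ i * (1 + \<alpha>) ^ j)"
    by (intro supported_mult_power) (auto simp: supported_def distrib_left simp del: dd)
  have 4: "supported (\<lambda>i j. i \<ge> 1) (\<alpha> * \<gamma> * (1 + \<gamma>) ^ i * (1 + \<alpha>) ^ j)"
    by (intro supported_mult_power) (auto simp: supported_def distrib_left simp del: dd)
  have 5: "supported (\<lambda>i j. j \<ge> 1) (\<gamma> * \<gamma> / \<alpha> * (1 + \<gamma>) ^ i * (1 + \<gamma> / \<alpha>) ^ j)"
    by (intro supported_mult_power) (auto simp: supported_def distrib_left simp del: dd)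
  have 6: "supported (\<lambda>i j. j \<ge> 1) (\<gamma> / \<alpha> / \<alpha> * (1 + 1 / \<alpha>) ^ i * (1 + \<gamma> / \<alpha>) ^ j)"
    by (intro supported_mult_power) (auto simp: supported_def distrib_left simp del: dd)
  have eqs: "1 / \<gamma> / (1 / \<alpha>) = \<alpha> / \<gamma>" "1 / \<alpha> / (1 / \<gamma>) = \<gamma> / \<alpha>"
    "1 / (1 / \<alpha>) = \<alpha>" "1 / (1 / \<gamma>) = \<gamma>" "\<alpha> / \<gamma> * (1 / \<gamma>) = \<alpha> / \<gamma> / \<gamma>"
    "\<alpha> / \<gamma> * \<alpha> = \<alpha> * \<alpha> / \<gamma>" "\<gamma> * \<alpha> = \<alpha> * \<gamma>"
    "\<gamma> * (\<gamma> / \<alpha>) = \<gamma> * \<gamma> / \<alpha>" "1 / \<alpha> * (\<gamma> / \<alpha>) = \<gamma> / \<alpha> / \<alpha>"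
    by simp_all
  show ?thesis
    unfolding bax_orbit_def Let_def eqs co_simps(1,2)
    using 1 supportedD[OF 2, of "-1" "-1"] supportedD[OF 3, of "-1" "-1"] supportedD[OF 4, of "-1" "-1"]
      supportedD[OF 5, of "-1" "-1"] supportedD[OF 6, of "-1" "-1"]
    by simp
qed

section \<open>Walks on the triangular lattice\<close>

text \<open>With middle variable 1 the kernel is \<open>2 + x + 1/x + z + 1/z + x/z + z/x\<close>.
  So this counts \<open>m\<close>-step walks from the origin to \<open>(p, q)\<close> with the six
  unit steps of the triangular lattice and two ways of standing still.\<close>

definition hex :: "nat \<Rightarrow> int \<Rightarrow> int \<Rightarrow> real" where
  "hex m p q = co (hex_kernel \<alpha> 1 \<gamma> ^ m) p q"

lemma kernel_mult_expand:
  fixes x z f :: "'a::field"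
  assumes "x \<noteq> 0" "z \<noteq> 0"
  shows "hex_kernel x 1 z * f = f + f + f * x + f / x + f * z + f / z + f * x / z + f * z / x"
  using assms by (simp add: hex_kernel_def field_simps)

lemma co_kernel_mult:
  "co (hex_kernel \<alpha> 1 \<gamma> * f) p q =
     2 * co f p q + co f (p - 1) q + co f (p + 1) q + co f p (q - 1) + co f p (q + 1)
     + co f (p - 1) (q + 1) + co f (p + 1) (q - 1)"
proof -
  have "hex_kernel \<alpha> 1 \<gamma> * f =
      f + f + f * \<alpha> + f / \<alpha> + f * \<gamma> + f / \<gamma> + f * \<alpha> / \<gamma> + f * \<gamma> / \<alpha>"
    by (rule kernel_mult_expand) simp_all
  then show ?thesis
    by (simp only: co_simps co_divide)
qed

lemma hex_0: "hex 0 p q = (if p = 0 \<and> q = 0 then 1 else 0)"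
  by (simp add: hex_def)

lemma hex_Suc:
  "hex (Suc m) p q = 2 * hex m p q + hex m (p - 1) q + hex m (p + 1) q + hex m p (q - 1) + hex m p (q + 1)
     + hex m (p - 1) (q + 1) + hex m (p + 1) (q - 1)"
  by (simp add: hex_def co_kernel_mult)

lemma hex_swap: "hex m p q = hex m q p"
  by (induction m arbitrary: p q) (auto simp: hex_0 hex_Suc)

lemma hex_uminus: "hex m p q = hex m (- p) (- q)"
proof (induction m arbitrary: p q)
  case (Suc m)
  have "hex m (p - 1) (q) = hex m (- p + 1) (- q)"
    "hex m (p + 1) (q) = hex m (- p - 1) (- q)"
    "hex m (p) (q - 1) = hex m (- p) (- q + 1)"
    "hex m (p) (q + 1) = hex m (- p) (- q - 1)"
    "hex m (p - 1) (q + 1) = hex m (- p + 1) (- q - 1)"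
    "hex m (p + 1) (q - 1) = hex m (- p - 1) (- q + 1)"
    by (rule trans[OF Suc.IH], rule arg_cong2[of _ _ _ _ "hex m"]; simp)+
  then show ?case
    unfolding hex_Suc using Suc.IH[of p q] by simp
qed (simp add: hex_0)

text \<open>In the coordinates \<open>p\<close>, \<open>q\<close>, \<open>-p-q\<close> the last two
  are exchanged, which permutes the steps. Together with \<open>hex_swap\<close> this gives all
  permutations of the three coordinates, and with \<open>hex_uminus\<close> the full group of order
  12.\<close>

lemma hex_rotate: "hex m p q = hex m p (- p - q)"
proof (induction m arbitrary: p q)
  case (Suc m)
  have "hex m (p - 1) (q) = hex m (p - 1) (- p - q + 1)"
    "hex m (p + 1) (q) = hex m (p + 1) (- p - q - 1)"
    "hex m (p) (q - 1) = hex m (p) (- p - q + 1)"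
    "hex m (p) (q + 1) = hex m (p) (- p - q - 1)"
    "hex m (p - 1) (q + 1) = hex m (p - 1) (- p - q)"
    "hex m (p + 1) (q - 1) = hex m (p + 1) (- p - q)"
    by (rule trans[OF Suc.IH], rule arg_cong2[of _ _ _ _ "hex m"]; simp)+
  then show ?case
    unfolding hex_Suc using Suc.IH[of p q] by simp
qed (auto simp: hex_0)

text \<open>The value of \<^const>\<open>hex\<close> at a point depends only on the largest and the smallest absolute value
  of its three coordinates \<open>p\<close>, \<open>q\<close>, \<open>-p-q\<close>.\<close>

definition hex_can :: "nat \<Rightarrow> int \<Rightarrow> int \<Rightarrow> real" where
  "hex_can m h l = hex m h (- l)"

text \<open>Used as a rewrite rule to bring values at numeral points into normal form; the separate
  constant on the right keeps the rewriting from looping.\<close>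

lemma hex_eq_hex_can:
  "hex m p q = hex_can m (max (max \<bar>p\<bar> \<bar>q\<bar>) \<bar>p + q\<bar>) (min (min \<bar>p\<bar> \<bar>q\<bar>) \<bar>p + q\<bar>)"
proof -
  define h where "h = hex m"
  have 1: "h p q = h q p" and 2: "h p q = h (- p) (- q)" and 3: "h p q = h p (- p - q)" for p q
    unfolding h_def by (rule hex_swap, rule hex_uminus, rule hex_rotate)
  have 4: "h p q = h (- p) (p + q)" for p q
    using 2[of p "- p - q"] 3[of p q] by (simp add: add.commute)
  have 5: "h p q = h (p + q) (- q)" for p q
    using 1[of p q] 4[of q p] 1[of "- q" "q + p"] by (simp add: add.commute)
  have 6: "h p q = h (p + q) (- p)" for p q
    using 4[of p q] 1[of "- p" "p + q"] by simp
  have 7: "h p q = h (- q) (p + q)" for p q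
    using 5[of p q] 1[of "p + q" "- q"] by simp
  have 8: "h p q = h (- q) (- p)" for p q
    using 2[of p q] 1[of "- p" "- q"] by simp
  have 9: "h p q = h q (- p - q)" for p q
    by (metis 1 3 minus_diff_commute)
  have 10: "h p q = h (- p - q) p" "h p q = h (- p - q) q" for p q
    using 3[of p q] 1[of p "- p - q"] 9[of p q] 1[of q "- p - q"] by simp_all
  let ?h = "max (max \<bar>p\<bar> \<bar>q\<bar>) \<bar>p + q\<bar>" and ?l = "- min (min \<bar>p\<bar> \<bar>q\<bar>) \<bar>p + q\<bar>"
  \<comment> \<open>The list contains the twelve images of \<open>(p, q)\<close>. Of three
    coordinates with sum 0, the one of largest absolute value has sign opposite to the others, so
    the canonical point is always among the images; fixing the signs and the order of the absolute
    values leaves linear arithmetic.\<close>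
  have "(?h, ?l) \<in> {(p, q), (q, p), (- p, - q), (- q, - p), (p, - p - q), (- p, p + q), (q, - p - q),
      (- q, p + q), (p + q, - p), (p + q, - q), (- p - q, p), (- p - q, q)}"
    by (cases "p \<ge> 0"; cases "q \<ge> 0"; cases "p + q \<ge> 0"; cases "\<bar>p\<bar> \<ge> \<bar>q\<bar>"; cases "\<bar>p\<bar> \<ge> \<bar>p + q\<bar>"; cases "\<bar>q\<bar> \<ge> \<bar>p + q\<bar>")
      (simp_all add: max_def min_def; linarith)+
  then have "h ?h ?l = h p q"
    using 1[of p q] 2[of p q] 3[of p q] 4[of p q] 5[of p q] 6[of p q] 7[of p q] 8[of p q] 9[of p q] 10[of p q]
    by (elim insertE; (simp only: prod.inject)?) (auto simp del: insert_iff)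
  then show ?thesis
    by (simp add: h_def hex_can_def)
qed

text \<open>Infinitesimal rotation invariance: the weight of a step \<open>s\<close> is its cross product with \<open>(p, q)\<close>.\<close>

lemma hex_moment:
  "real_of_int q * (hex m (p + 1) q - hex m (p - 1) q) - real_of_int p * (hex m p (q + 1) - hex m p (q - 1))
     + real_of_int (p + q) * (hex m (p + 1) (q - 1) - hex m (p - 1) (q + 1)) = 0" (is "?L m p q = 0")
proof (induction m arbitrary: p q)
  case 0
  then show ?case by (auto simp: hex_0)
next
  case (Suc m)
  \<comment> \<open>Moving the weights past a step \<open>s\<close> produces the error terms cross
    product of \<open>t\<close> and \<open>s\<close> times the value at
    \<open>(p, q) + s + t\<close>, summed over all pairs of steps. These are antisymmetric in
    \<open>s\<close> and \<open>t\<close> and cancel. Equivalently, the Jacobian of the kernel and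
    its \<open>m\<close>-th power vanishes.\<close>
  have "?L (Suc m) p q = 2 * ?L m p q + ?L m (p - 1) q + ?L m (p + 1) q + ?L m p (q - 1) + ?L m p (q + 1)
     + ?L m (p - 1) (q + 1) + ?L m (p + 1) (q - 1)"
    unfolding hex_Suc by (simp add: algebra_simps)
  then show ?case
    by (simp only: Suc.IH)
qed

text \<open>Each of the three factors of the kernel contributes one binomial coefficient:
  \<open>r\<close> is the exponent of \<alpha> chosen from \<open>(\<alpha> + \<gamma>)^m\<close>,
  and the binomial coming from \<open>(1 + \<alpha>)^m\<close> is reflected.\<close>

lemma hex_sum: "hex m p q = (\<Sum>r\<le>m. real (m choose r) * binom m (int r - p) * binom m (int r + q))"
proof -
  have b: "binom n i = binom n (int n - i)" for n i
    by (cases "i < 0 \<or> int n < i") (auto simp: binom_def nat_diff_distrib' intro: binomial_symmetric)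
  have "hex_kernel \<alpha> 1 \<gamma> ^ m = ((1 + \<alpha>) ^ m * (1 + \<gamma>) ^ m) * (\<alpha> + \<gamma>) ^ m / \<alpha> ^ m / \<gamma> ^ m"
    by (simp add: hex_kernel_def power_divide power_mult_distrib add_ac)
  also have "(\<alpha> + \<gamma>) ^ m = (\<Sum>r\<le>m. of_nat (m choose r) * \<alpha> ^ r * \<gamma> ^ (m - r))"
    by (rule binomial_ring)
  also have "(1 + \<alpha>) ^ m * (1 + \<gamma>) ^ m * \<dots> / \<alpha> ^ m / \<gamma> ^ m =
      (\<Sum>r\<le>m. of_nat (m choose r) * ((1 + \<alpha>) ^ m * (1 + \<gamma>) ^ m / \<alpha> ^ (m - r) / \<gamma> ^ r))"
    unfolding sum_distrib_left sum_divide_distrib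
  proof (rule sum.cong)
    fix r assume "r \<in> {..m}"
    then have "\<alpha> ^ m = \<alpha> ^ r * \<alpha> ^ (m - r)" "\<gamma> ^ m = \<gamma> ^ r * \<gamma> ^ (m - r)"
      by (simp_all flip: power_add)
    then show "(1 + \<alpha>) ^ m * (1 + \<gamma>) ^ m * (of_nat (m choose r) * \<alpha> ^ r * \<gamma> ^ (m - r)) / \<alpha> ^ m / \<gamma> ^ m =
       of_nat (m choose r) * ((1 + \<alpha>) ^ m * (1 + \<gamma>) ^ m / \<alpha> ^ (m - r) / \<gamma> ^ r)"
      by (simp add: field_simps)
  qed simp
  finally have e: "hex_kernel \<alpha> 1 \<gamma> ^ m = \<dots>" .
  have o: "co (of_nat n * f) i j = real n * co f i j" for n f i j
    by (induction n) (simp_all add: distrib_right)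
  have "hex m p q = (\<Sum>r\<le>m. real (m choose r) * binom m (p + int (m - r)) * binom m (q + int r))"
    unfolding hex_def e by (simp add: co_sum o co_divide_power co_1_plus_al_ga_power mult.assoc del: divide_divide_eq_left)
  also have "\<dots> = (\<Sum>r\<le>m. real (m choose r) * binom m (int r - p) * binom m (int r + q))"
  proof (rule sum.cong)
    fix r assume "r \<in> {..m}"
    then have "binom m (p + int (m - r)) = binom m (int r - p)"
      by (subst b) (simp add: of_nat_diff algebra_simps)
    then show "real (m choose r) * binom m (p + int (m - r)) * binom m (q + int r) =
        real (m choose r) * binom m (int r - p) * binom m (int r + q)"
      by (simp add: add.commute)
  qed simp
  finally show ?thesis .
qed

text \<open>The six monomials of the antisymmetrised \<open>u * v\<close>, collected by lattice
  symmetry: the origin, two points equivalent to \<open>(1, 1)\<close>, two equivalent to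
  \<open>(3, 0)\<close>, and one equivalent to \<open>(2, 2)\<close>. It has the shape of a
  reflection-principle sum for the Weyl group of type A2.\<close>

definition bax_total :: "nat \<Rightarrow> real" where
  "bax_total m = hex m 0 0 - 2 * hex m 1 1 + 2 * hex m 3 0 - hex m 2 2"

lemma co_kernel_bax_orbit_root: "co (hex_kernel \<alpha> 1 \<gamma> ^ m * bax_orbit (1 / \<alpha>) (1 / \<gamma>) 0 0) (-1) (-1) = bax_total m"
proof -
  let ?K = "hex_kernel \<alpha> 1 \<gamma> ^ m"
  have "?K * bax_orbit (1 / \<alpha>) (1 / \<gamma>) 0 0 = ?K / \<alpha> / \<gamma> - ?K * \<alpha> / \<gamma> / \<gamma> + ?K * \<alpha> * \<alpha> / \<gamma> - ?K * \<alpha> * \<gamma>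
      + ?K * \<gamma> * \<gamma> / \<alpha> - ?K * \<gamma> / \<alpha> / \<alpha>"
    by (simp add: bax_orbit_def Let_def field_simps)
  then have "co (?K * bax_orbit (1 / \<alpha>) (1 / \<gamma>) 0 0) (-1) (-1) =
      hex m 0 0 - hex m (-2) 1 + hex m (-3) 0 - hex m (-2) (-2) + hex m 0 (-3) - hex m 1 (-2)"
    by (simp only: co_simps co_divide hex_def) simp
  then show ?thesis
    unfolding bax_total_def by (simp add: hex_eq_hex_can)
qed

text \<open>One kernel factor cancels the factor \<open>p + q\<close> in the denominator of each
  root term. What remains is a Laurent polynomial whose denominators divide
  \<open>x^3 * z^3\<close>, so that its coefficients no longer depend on a direction of
  expansion.\<close>

lemma kernel_sis_orbit_root:
  fixes x z :: "'a::field"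
  assumes nz: "x \<noteq> 0" "z \<noteq> 0" "x + 1 \<noteq> 0" "1 + z \<noteq> 0" "x + z \<noteq> 0"
  shows "x ^ 3 * z ^ 3 * (hex_kernel x 1 z * sis_orbit x 1 z 0 0) =
    (z ^ 6) + 2 * (z ^ 5) - 2 * (z ^ 3) - (z ^ 2) + 2 * (x * z ^ 5) + 2 * (x * z ^ 4) - 2 * (x * z ^ 3) - 2 * (x * z ^ 2) - (x ^ 2 * z ^ 6) - 2 * (x ^ 2 * z ^ 5) + 2 * (x ^ 2 * z) + (x ^ 2) - 2 * (x ^ 3 * z ^ 5) - 2 * (x ^ 3 * z ^ 4) + 2 * (x ^ 3 * z) + 2 * (x ^ 3) + 2 * (x ^ 4 * z ^ 3) - 2 * (x ^ 4 * z) + 2 * (x ^ 5 * z ^ 3) + 2 * (x ^ 5 * z ^ 2) - 2 * (x ^ 5 * z) - 2 * (x ^ 5) + (x ^ 6 * z ^ 2) - (x ^ 6)"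
proof -
  have t: "hex_kernel x 1 z * sis_term p q r 0 0 = (x + 1 + z) * (q + r) * (r + p) / (p ^ 3 * q)"
    if "p \<noteq> 0" "q \<noteq> 0" "r \<noteq> 0" "p + q \<noteq> 0" "hex_kernel x 1 z = hex_kernel p q r" "p + q + r = x + 1 + z" for p q r
  proof -
    have "w * (q + r) * (r + p) / (p * q * r) * (s * r / (p\<^sup>2 * w)) = s * (q + r) * (r + p) / (p ^ 3 * q)"
      if "w \<noteq> 0" for w s
      using \<open>p \<noteq> 0\<close> \<open>q \<noteq> 0\<close> \<open>r \<noteq> 0\<close> that by (simp add: field_simps power2_eq_square power3_eq_cube)
    from this[OF that(4)] show ?thesis
      unfolding that(5) by (simp add: hex_kernel_def sis_term_def that(6))
  qed
  have nz': "1 + x \<noteq> 0" "z + 1 \<noteq> 0" "z + x \<noteq> 0"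
    using nz by (simp_all add: add.commute)
  have e: "hex_kernel x 1 z * sis_orbit x 1 z 0 0 =
      (x + 1 + z) * (1 + z) * (z + x) / (x ^ 3 * 1) - (x + 1 + z) * (z + 1) * (1 + x) / (x ^ 3 * z)
    + (x + 1 + z) * (z + x) * (x + 1) / (1 ^ 3 * z) - (x + 1 + z) * (x + z) * (z + 1) / (1 ^ 3 * x)
    + (x + 1 + z) * (x + 1) * (1 + z) / (z ^ 3 * x) - (x + 1 + z) * (1 + x) * (x + z) / (z ^ 3 * 1)"
  proof -
    have k: "hex_kernel x 1 z = hex_kernel x z 1" "hex_kernel x 1 z = hex_kernel 1 z x" "hex_kernel x 1 z = hex_kernel 1 x z"
      "hex_kernel x 1 z = hex_kernel z x 1" "hex_kernel x 1 z = hex_kernel z 1 x"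
      by (simp_all add: hex_kernel_def mult_ac add_ac)
    have c: "x + z + 1 = x + 1 + z" "1 + z + x = x + 1 + z" "1 + x + z = x + 1 + z"
      "z + x + 1 = x + 1 + z" "z + 1 + x = x + 1 + z"
      by (simp_all add: add_ac)
    show ?thesis
      unfolding sis_orbit_def distrib_left[of "hex_kernel x 1 z"] right_diff_distrib[of "hex_kernel x 1 z"]
        t[OF nz(1) one_neq_zero nz(2,3) refl refl] t[OF nz(1,2) one_neq_zero nz(5) k(1) c(1)]
        t[OF one_neq_zero nz(2,1) nz(4) k(2) c(2)] t[OF one_neq_zero nz(1,2) nz'(1) k(3) c(3)]
        t[OF nz(2,1) one_neq_zero nz'(3) k(4) c(4)] t[OF nz(2) one_neq_zero nz(1) nz'(2) k(5) c(5)]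
      by (rule refl)
  qed
  have "x ^ 3 * z ^ 3 * (hex_kernel x 1 z * sis_orbit x 1 z 0 0) =
      (x + 1 + z) * (1 + z) * (z + x) * z ^ 3 - (x + 1 + z) * (z + 1) * (1 + x) * z\<^sup>2
    + (x + 1 + z) * (z + x) * (x + 1) * x ^ 3 * z\<^sup>2 - (x + 1 + z) * (x + z) * (z + 1) * x\<^sup>2 * z ^ 3
    + (x + 1 + z) * (x + 1) * (1 + z) * x\<^sup>2 - (x + 1 + z) * (1 + x) * (x + z) * x ^ 3"
  proof -
    have "x ^ 3 * z ^ 3 * (w1 / (x ^ 3 * 1) - w2 / (x ^ 3 * z) + w3 / (1 ^ 3 * z) - w4 / (1 ^ 3 * x) + w5 / (z ^ 3 * x) - w6 / (z ^ 3 * 1)) =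
        w1 * z ^ 3 - w2 * z\<^sup>2 + w3 * x ^ 3 * z\<^sup>2 - w4 * x\<^sup>2 * z ^ 3 + w5 * x\<^sup>2 - w6 * x ^ 3" for w1 w2 w3 w4 w5 w6
      using nz(1,2) by (simp add: field_simps power2_eq_square power3_eq_cube)
    then show ?thesis
      unfolding e .
  qed
  also have "\<dots> = (z ^ 6) + 2 * (z ^ 5) - 2 * (z ^ 3) - (z ^ 2) + 2 * (x * z ^ 5) + 2 * (x * z ^ 4) - 2 * (x * z ^ 3) - 2 * (x * z ^ 2) - (x ^ 2 * z ^ 6) - 2 * (x ^ 2 * z ^ 5) + 2 * (x ^ 2 * z) + (x ^ 2) - 2 * (x ^ 3 * z ^ 5) - 2 * (x ^ 3 * z ^ 4) + 2 * (x ^ 3 * z) + 2 * (x ^ 3) + 2 * (x ^ 4 * z ^ 3) - 2 * (x ^ 4 * z) + 2 * (x ^ 5 * z ^ 3) + 2 * (x ^ 5 * z ^ 2) - 2 * (x ^ 5 * z) - 2 * (x ^ 5) + (x ^ 6 * z ^ 2) - (x ^ 6)"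
    by (simp add: algebra_simps power_numeral_reduce)
  finally show ?thesis .
qed

lemma co_kernel_sis_orbit_root:
  "co (hex_kernel \<alpha> 1 \<gamma> ^ m * sis_orbit \<alpha> 1 \<gamma> 0 0) (-2) 1 = bax_total m"
proof (cases m)
  \<comment> \<open>No kernel factor is available to clear the denominators; here the extraction for
    a single node gives the value 1.\<close>
  case 0
  then show ?thesis by (simp add: co_sis_orbit bax_total_def hex_0)
next
  case (Suc n)
  let ?K = "hex_kernel \<alpha> 1 \<gamma>"
  have num: "co (f * numeral k) i j = numeral k * co f i j" for k f i j
  proof -
    have "co (f * of_nat m) i j = real m * co f i j" for m
      by (induction m) (simp_all add: distrib_left distrib_right)
    from this[of "numeral k"] show ?thesis by simp
  qed
  have mon: "co (f * \<alpha> ^ a) i j = co f (i - int a) j" "co (f * \<gamma> ^ a) i j = co f i (j - int a)" for f a i j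
  proof -
    show "co (f * \<alpha> ^ a) i j = co f (i - int a) j"
    proof (induction a arbitrary: i)
      case (Suc a)
      have "f * \<alpha> ^ Suc a = f * \<alpha> ^ a * \<alpha>" by simp
      then show ?case by (simp only: co_simps Suc.IH) (simp add: algebra_simps)
    qed simp
    show "co (f * \<gamma> ^ a) i j = co f i (j - int a)"
    proof (induction a arbitrary: j)
      case (Suc a)
      have "f * \<gamma> ^ Suc a = f * \<gamma> ^ a * \<gamma>" by simp
      then show ?case by (simp only: co_simps Suc.IH) (simp add: algebra_simps)
    qed simp
  qed
  have "?K ^ m * sis_orbit \<alpha> 1 \<gamma> 0 0 = ?K ^ n * (\<alpha> ^ 3 * \<gamma> ^ 3 * (?K * sis_orbit \<alpha> 1 \<gamma> 0 0)) / \<alpha> ^ 3 / \<gamma> ^ 3"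
    by (simp add: Suc)
  then have "co (?K ^ m * sis_orbit \<alpha> 1 \<gamma> 0 0) (-2) 1 =
      co (?K ^ n * (\<alpha> ^ 3 * \<gamma> ^ 3 * (?K * sis_orbit \<alpha> 1 \<gamma> 0 0))) 1 4"
    by (simp only: co_divide_power) simp
  also have "\<alpha> ^ 3 * \<gamma> ^ 3 * (?K * sis_orbit \<alpha> 1 \<gamma> 0 0) =
    (\<gamma> ^ 6) + 2 * (\<gamma> ^ 5) - 2 * (\<gamma> ^ 3) - (\<gamma> ^ 2) + 2 * (\<alpha> * \<gamma> ^ 5) + 2 * (\<alpha> * \<gamma> ^ 4) - 2 * (\<alpha> * \<gamma> ^ 3) - 2 * (\<alpha> * \<gamma> ^ 2) - (\<alpha> ^ 2 * \<gamma> ^ 6) - 2 * (\<alpha> ^ 2 * \<gamma> ^ 5) + 2 * (\<alpha> ^ 2 * \<gamma>) + (\<alpha> ^ 2) - 2 * (\<alpha> ^ 3 * \<gamma> ^ 5) - 2 * (\<alpha> ^ 3 * \<gamma> ^ 4) + 2 * (\<alpha> ^ 3 * \<gamma>) + 2 * (\<alpha> ^ 3) + 2 * (\<alpha> ^ 4 * \<gamma> ^ 3) - 2 * (\<alpha> ^ 4 * \<gamma>) + 2 * (\<alpha> ^ 5 * \<gamma> ^ 3) + 2 * (\<alpha> ^ 5 * \<gamma> ^ 2) - 2 * (\<alpha> ^ 5 * \<gamma>) - 2 * (\<alpha> ^ 5) + (\<alpha> ^ 6 * \<gamma> ^ 2) - (\<alpha> ^ 6)"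
    by (rule kernel_sis_orbit_root) (simp_all add: sums_nonzero)
  \<comment> \<open>Clearing \<open>\<alpha>^3 * \<gamma>^3\<close> has moved the extraction from
    \<open>(-2, 1)\<close> to \<open>(1, 4)\<close>, so a monomial
    \<open>\<alpha>^a * \<gamma>^b\<close> contributes \<open>hex n (1 - a) (4 - b)\<close>.\<close>
  also have "co (?K ^ n * (\<dots>)) 1 4 =
    hex n (1) (-2) + 2 * hex n (1) (-1) - 2 * hex n (1) (1) - hex n (1) (2) + 2 * hex n (0) (-1) + 2 * hex n (0) (0) - 2 * hex n (0) (1) - 2 * hex n (0) (2) - hex n (-1) (-2) - 2 * hex n (-1) (-1) + 2 * hex n (-1) (3) + hex n (-1) (4) - 2 * hex n (-2) (-1) - 2 * hex n (-2) (0) + 2 * hex n (-2) (3) + 2 * hex n (-2) (4) + 2 * hex n (-3) (1) - 2 * hex n (-3) (3) + 2 * hex n (-4) (1) + 2 * hex n (-4) (2) - 2 * hex n (-4) (3) - 2 * hex n (-4) (4) + hex n (-5) (2) - hex n (-5) (4)"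
    unfolding distrib_left right_diff_distrib mult.assoc [symmetric] co_simps(1,2) num mon co_simps(7,9) hex_def
    by simp
  also have "\<dots> = bax_total (Suc n)"
    \<comment> \<open>One walk step of \<open>bax_total (Suc n)\<close> is unfolded, so both sides
      are combinations of values for \<open>n\<close> in normal form. The moment identity at
      \<open>(p, q) = (3, -1)\<close> and \<open>(4, -1)\<close> supplies the linear relations
      between them.\<close>
    using hex_moment[of "-1" n 3] hex_moment[of "-1" n 4]
    unfolding bax_total_def hex_Suc by (simp add: hex_eq_hex_can)
  finally show ?thesis by (simp add: Suc)
qed

section \<open>Binomial determinants and the Baxter numbers\<close>

lemma baxter_determinant_aux:
  fixes r s c :: real
  assumes "r \<ge> 0" "s \<ge> 0"
  defines "b1 \<equiv> r * c / (s + 1)" and "c1 \<equiv> s * c / (r + 1)"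
  defines "b2 \<equiv> (r - 1) * b1 / (s + 2)" and "c2 \<equiv> (s - 1) * c1 / (r + 2)"
  shows "c * c * c - 2 * (c * b1 * c1) + c1 * c1 * b2 + b1 * b1 * c2 - c * b2 * c2 =
    2 / ((r + s + 1) * (r + s + 2)\<^sup>2) * ((c + 2 * b1 + b2) * (c1 + 2 * c + b1) * (c2 + 2 * c1 + c))"
proof -
  define R S where "R = r + 1" and "S = s + 1"
  define R' S' N N' where "R' = r + 2" and "S' = s + 2" and "N = r + s + 1" and "N' = r + s + 2"
  have pos: "R > 0" "S > 0" "R' > 0" "S' > 0" "N > 0" "N' > 0"
    using assms(1,2) by (simp_all add: R_def S_def R'_def S'_def N_def N'_def)
  have b1: "b1 = r * c / S" and c1: "c1 = s * c / R" and b2: "b2 = (r - 1) * (r * c) / (S * S')"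
    and c2: "c2 = (s - 1) * (s * c) / (R * R')"
    by (simp_all add: b1_def c1_def b2_def c2_def S_def R_def S'_def R'_def)
  have 1: "c + 2 * b1 + b2 = c * N * N' / (S * S')"
  proof -
    have "c + 2 * b1 + b2 = c * (S * S' + 2 * r * S' + (r - 1) * r) / (S * S')"
      using pos unfolding b1 b2 by (simp add: field_simps)
    also have "S * S' + 2 * r * S' + (r - 1) * r = N * N'"
      unfolding S_def S'_def N_def N'_def by (simp add: algebra_simps)
    finally show ?thesis by (simp add: mult_ac)
  qed
  have 2: "c2 + 2 * c1 + c = c * N * N' / (R * R')"
  proof -
    have "c2 + 2 * c1 + c = c * (R * R' + 2 * s * R' + (s - 1) * s) / (R * R')"
      using pos unfolding c1 c2 by (simp add: field_simps)
    also have "R * R' + 2 * s * R' + (s - 1) * s = N * N'"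
      unfolding R_def R'_def N_def N'_def by (simp add: algebra_simps)
    finally show ?thesis by (simp add: mult_ac)
  qed
  have 3: "c1 + 2 * c + b1 = c * N * N' / (R * S)"
  proof -
    have "c1 + 2 * c + b1 = c * (s * S + 2 * R * S + r * R) / (R * S)"
      using pos unfolding c1 b1 by (simp add: field_simps)
    also have "s * S + 2 * R * S + r * R = N * N'"
      unfolding R_def S_def N_def N'_def by (simp add: algebra_simps)
    finally show ?thesis by (simp add: mult_ac)
  qed
  \<comment> \<open>All entries are rational multiples of \<open>c\<close>, so \<open>c^3\<close>
    factors out over a common denominator and only a polynomial identity in \<open>r\<close> and
    \<open>s\<close> is left.\<close>
  have "c * c * c - 2 * (c * b1 * c1) + c1 * c1 * b2 + b1 * b1 * c2 - c * b2 * c2 =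
     c ^ 3 * (R\<^sup>2 * R' * S\<^sup>2 * S' - 2 * r * s * R * R' * S * S' + s\<^sup>2 * (r - 1) * r * R' * S
       + r\<^sup>2 * (s - 1) * s * R * S' - (r - 1) * r * (s - 1) * s * R * S) / (R\<^sup>2 * R' * S\<^sup>2 * S')"
    using pos unfolding b1 c1 b2 c2 by (simp add: field_simps power2_eq_square power3_eq_cube)
  also have "R\<^sup>2 * R' * S\<^sup>2 * S' - 2 * r * s * R * R' * S * S' + s\<^sup>2 * (r - 1) * r * R' * S
       + r\<^sup>2 * (s - 1) * s * R * S' - (r - 1) * r * (s - 1) * s * R * S = 2 * N\<^sup>2 * N'"
    unfolding R_def S_def R'_def S'_def N_def N'_def by (simp add: algebra_simps power2_eq_square)
  also have "c ^ 3 * (2 * N\<^sup>2 * N') / (R\<^sup>2 * R' * S\<^sup>2 * S') =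
      2 / (N * N'\<^sup>2) * (c * N * N' / (S * S') * (c * N * N' / (R * S)) * (c * N * N' / (R * R')))"
    using pos by (simp add: field_simps power2_eq_square power3_eq_cube)
  finally show ?thesis
    unfolding 1 2 3 N_def N'_def .
qed

text \<open>Absorption in a division-free form that holds for every integer \<open>i\<close>; it
  yields the ratios of neighbouring binomials near \<open>r\<close> even where \<open>r - 1\<close>
  or \<open>r - 2\<close> is negative.\<close>

lemma binom_succ: "(real_of_int i + 1) * binom m (i + 1) = (real m - real_of_int i) * binom m i"
proof (cases "i < 0")
  case True
  then show ?thesis by (cases "i = -1") (auto simp: binom_def)
next
  case False
  define k where "k = nat i"
  have i: "i = int k" using False by (simp add: k_def)
  have "Suc k * (m choose Suc k) = (m - k) * (m choose k)"
    using binomial_absorption[of k m] binomial_absorb_comp[of m k] by simp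
  then have "real (Suc k) * real (m choose Suc k) = real (m - k) * real (m choose k)"
    by (metis of_nat_mult)
  also have "\<dots> = (real m - real k) * real (m choose k)"
    by (cases "k \<le> m") (auto simp: of_nat_diff binomial_eq_0)
  finally show ?thesis
    by (simp add: i binom_def nat_add_distrib add.commute)
qed

text \<open>The left side is the 3 by 3 Toeplitz determinant of the binomials
  \<open>b (j - i)\<close>, which counts triples of non-intersecting lattice paths by Lindstroem,
  Gessel and Viennot. The factors on the right come from the same entries by applying Pascal's rule
  twice.\<close>

lemma baxter_determinant:
  assumes "r \<le> m"
  defines "b \<equiv> \<lambda>i. binom m (int r + i)"
  shows "b 0 * b 0 * b 0 - 2 * (b 0 * b (-1) * b 1) + b 1 * b 1 * b (-2) + b (-1) * b (-1) * b 2 - b 0 * b (-2) * b 2 =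
    2 / ((real m + 1) * (real m + 2)\<^sup>2) *
      (real ((m + 2) choose r) * real ((m + 2) choose (r + 1)) * real ((m + 2) choose (r + 2)))"
proof -
  define s where "s = m - r"
  have m: "m = r + s" using assms(1) by (simp add: s_def)
  have 1: "b (-1) = real r * b 0 / (real s + 1)"
    using binom_succ[of "int r - 1" m] by (simp add: b_def m field_simps)
  have 2: "b 1 = real s * b 0 / (real r + 1)"
    using binom_succ[of "int r" m] by (simp add: b_def m field_simps)
  have 3: "b (-2) = (real r - 1) * b (-1) / (real s + 2)"
    using binom_succ[of "int r - 2" m] by (simp add: b_def m field_simps)
  have 4: "b 2 = (real s - 1) * b 1 / (real r + 2)"
    using binom_succ[of "int r + 1" m] by (simp add: b_def m field_simps)
  have p: "binom (Suc (Suc n)) i = binom n i + 2 * binom n (i - 1) + binom n (i - 2)" for n i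
    by (simp add: binom_Suc)
  have c: "real ((m + 2) choose k) = binom (Suc (Suc m)) (int k)" for k
    by (simp add: binom_def)
  have 5: "real ((m + 2) choose r) = b 0 + 2 * b (-1) + b (-2)"
    unfolding c p by (simp add: b_def)
  have 6: "real ((m + 2) choose (r + 1)) = b 1 + 2 * b 0 + b (-1)"
    unfolding c p by (simp add: b_def add.commute)
  have 7: "real ((m + 2) choose (r + 2)) = b 2 + 2 * b 1 + b 0"
    unfolding c p by (simp add: b_def add.commute)
  have "real m = real r + real s" by (simp add: m)
  then show ?thesis
    using baxter_determinant_aux[of "real r" "real s" "b 0"]
    unfolding 5 6 7 1[symmetric] 2[symmetric] 3[symmetric] 4[symmetric] by simp
qed

lemma bax_total_eq_baxter_number: "bax_total m = baxter_number (Suc m)"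
proof -
  define b where "b = (\<lambda>r i. binom m (int r + i))"
  have b: "real (m choose r) = b r 0" for r
    by (simp add: b_def binom_def)
  have hex: "hex m p q = (\<Sum>r\<le>m. b r 0 * b r (- p) * b r q)" for p q
    unfolding hex_sum b by (simp add: b_def)
  \<comment> \<open>The sum for \<open>hex m 3 0\<close> becomes the sum of a determinant term when
    \<open>r\<close> is shifted by one; both boundary terms vanish because they contain a binomial
    with lower index outside \<open>0..m\<close>.\<close>
  have shift1: "(\<Sum>r\<le>m. b r 0 * b r (-3) * b r 0) = (\<Sum>r\<le>m. b r 1 * b r 1 * b r (-2))"
  proof -
    define g where "g r = b r 0 * b r (-3) * b r 0" for r
    have "(\<Sum>r\<le>m. g r - g (Suc r)) = g 0 - g (Suc m)"
      by (rule sum_telescope)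
    also have "\<dots> = 0" by (simp add: g_def b_def binom_def nat_add_distrib)
    finally have "(\<Sum>r\<le>m. g r) = (\<Sum>r\<le>m. g (Suc r))"
      by (simp add: sum_subtractf)
    also have "\<dots> = (\<Sum>r\<le>m. b r 1 * b r 1 * b r (-2))"
      by (simp add: g_def b_def algebra_simps)
    finally show ?thesis by (simp add: g_def)
  qed
  have shift2: "(\<Sum>r\<le>m. b r 0 * b r 0 * b r 3) = (\<Sum>r\<le>m. b r (-1) * b r (-1) * b r 2)"
  proof -
    define g where "g r = b r (-1) * b r (-1) * b r 2" for r
    have "(\<Sum>r\<le>m. g r - g (Suc r)) = g 0 - g (Suc m)"
      by (rule sum_telescope)
    also have "\<dots> = 0" by (simp add: g_def b_def binom_def nat_add_distrib)
    finally have "(\<Sum>r\<le>m. g (Suc r)) = (\<Sum>r\<le>m. g r)"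
      by (simp add: sum_subtractf)
    moreover have "(\<Sum>r\<le>m. g (Suc r)) = (\<Sum>r\<le>m. b r 0 * b r 0 * b r 3)"
      by (simp add: g_def b_def algebra_simps)
    ultimately show ?thesis by (simp add: g_def)
  qed
  \<comment> \<open>The two equal values are written as \<open>hex m 3 0\<close> and
    \<open>hex m 0 3\<close> because they have to yield two different products of the
    determinant.\<close>
  have "bax_total m = hex m 0 0 - 2 * hex m 1 1 + hex m 3 0 + hex m 0 3 - hex m 2 2"
    by (simp add: bax_total_def hex_swap[of m 0 3])
  also have "\<dots> = (\<Sum>r\<le>m. b r 0 * b r 0 * b r 0 - 2 * (b r 0 * b r (-1) * b r 1) + b r 1 * b r 1 * b r (-2)
      + b r (-1) * b r (-1) * b r 2 - b r 0 * b r (-2) * b r 2)"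
    unfolding hex by (simp add: shift1 shift2 sum.distrib sum_subtractf sum_distrib_left)
  also have "\<dots> = (\<Sum>r\<le>m. 2 / ((real m + 1) * (real m + 2)\<^sup>2) *
      (real ((m + 2) choose r) * real ((m + 2) choose (r + 1)) * real ((m + 2) choose (r + 2))))"
    unfolding b_def by (intro sum.cong refl baxter_determinant) simp
  also have "\<dots> = baxter_number (Suc m)"
  proof -
    have e: "(\<Sum>k=1..Suc m. f k) = (\<Sum>r\<le>m. f (Suc r))" for f :: "nat \<Rightarrow> real"
      by (metis One_nat_def lessThan_Suc_atMost sum.atLeast1_atMost_eq)
    have n: "r + 1 + 1 = r + 2" "r + 1 - 1 = r" "real (r + 1) = real r + 1" "real r + 1 + 1 = real r + 2" for r
      by simp_all
    show ?thesis
      unfolding baxter_number_def e unfolding sum_distrib_left Suc_eq_plus1 n ..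
  qed
  finally show ?thesis .
qed

section \<open>Growth of permutations by insertion\<close>

definition insert_at :: "'a \<Rightarrow> nat \<Rightarrow> 'a list \<Rightarrow> 'a list" where
  "insert_at m p w = take p w @ m # drop p w"

lemma bij_betw_insert_at:
  assumes "m \<notin> A" "finite A"
  shows "bij_betw (\<lambda>(w, p). insert_at m p w) (permutations_of_set A \<times> {..card A})
           (permutations_of_set (insert m A))"
  unfolding bij_betw_def
proof (intro conjI set_eqI iffI)
  have m: "m \<notin> set (take p w)" "length w = card A" "m \<notin> set (drop p w)" if "w \<in> permutations_of_set A" for p w
    using that assms(1) distinct_card[of w] by (auto simp: permutations_of_set_def dest: in_set_takeD in_set_dropD)
  show "inj_on (\<lambda>(w, p). insert_at m p w) (permutations_of_set A \<times> {..card A})"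
  proof (rule inj_onI; clarify)
    fix w p w' p'
    assume w: "w \<in> permutations_of_set A" "w' \<in> permutations_of_set A" and p: "p \<le> card A" "p' \<le> card A"
      and "insert_at m p w = insert_at m p' w'"
    then have e: "take p w @ m # drop p w = take p' w' @ m # drop p' w'"
      by (simp add: insert_at_def)
    have t: "take p w = take p' w'" "drop p w = drop p' w'"
      using e by (simp_all add: append_Cons_eq_iff[OF m(1)[OF w(1)] m(3)[OF w(1)]])
    then have "length (take p w) = length (take p' w')" "take p w @ drop p w = take p' w' @ drop p' w'"
      by simp_all
    then show "w = w' \<and> p = p'"
      using p m(2)[OF w(1)] m(2)[OF w(2)] by simp
  qed
next
  fix w' assume "w' \<in> permutations_of_set (insert m A)"
  then have w': "set w' = insert m A" "distinct w'"
    by (auto simp: permutations_of_set_def)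
  then obtain u v where uv: "w' = u @ m # v"
    by (metis insertI1 split_list)
  with w' have "u @ v \<in> permutations_of_set A"
    using assms(1) by (auto simp: permutations_of_set_def)
  moreover from this have "length u \<le> card A"
    using distinct_card[of "u @ v"] by (auto simp: permutations_of_set_def)
  moreover have "w' = insert_at m (length u) (u @ v)"
    by (simp add: insert_at_def uv)
  ultimately show "w' \<in> (\<lambda>(w, p). insert_at m p w) ` (permutations_of_set A \<times> {..card A})"
    by force
next
  fix w' assume "w' \<in> (\<lambda>(w, p). insert_at m p w) ` (permutations_of_set A \<times> {..card A})"
  then obtain w p where w': "w' = insert_at m p w" "set w = A" "distinct w"
    by (auto simp: permutations_of_set_def)
  have "set (take p w) \<union> set (drop p w) = A" "set (take p w) \<inter> set (drop p w) = {}"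
    using w' set_take_disj_set_drop_if_distinct[of w p p] by (simp_all flip: set_append)
  then show "w' \<in> permutations_of_set (insert m A)"
    using assms(1) w' unfolding permutations_of_set_def insert_at_def by auto
qed

text \<open>The level step of a generating tree, for an arbitrary inserted letter: a sum over the
  children level is a double sum over parents and their admissible sites. It serves for new minima
  as well as new maxima.\<close>

lemma sum_permutations_insert:
  fixes f :: "'a list \<Rightarrow> 'b::comm_monoid_add"
  assumes "m \<notin> A" "finite A"
    and PS: "\<And>w p. w \<in> permutations_of_set A \<Longrightarrow> p \<le> card A \<Longrightarrow> P (insert_at m p w) \<longleftrightarrow> P w \<and> S w p"
  shows "(\<Sum>w \<in> {w \<in> permutations_of_set (insert m A). P w}. f w) =
           (\<Sum>w \<in> {w \<in> permutations_of_set A. P w}. \<Sum>p \<in> {p. p \<le> card A \<and> S w p}. f (insert_at m p w))"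
proof -
  let ?D = "SIGMA w:{w \<in> permutations_of_set A. P w}. {p. p \<le> card A \<and> S w p}"
  let ?X = "permutations_of_set A \<times> {..card A}" and ?f = "\<lambda>(w, p). insert_at m p w"
  have X: "?f ` ?X = permutations_of_set (insert m A)"
    using bij_betw_insert_at[OF assms(1,2)] by (simp add: bij_betw_def)
  have "?f ` ?D = {w \<in> permutations_of_set (insert m A). P w}"
  proof (intro set_eqI iffI)
    fix y assume "y \<in> ?f ` ?D"
    then obtain w p where wp: "w \<in> permutations_of_set A" "p \<le> card A" "P w" "S w p" "y = ?f (w, p)"
      by auto
    then have "y \<in> ?f ` ?X" by blast
    then show "y \<in> {w \<in> permutations_of_set (insert m A). P w}"
      using wp PS[of w p] X by simp
  next
    fix y assume y: "y \<in> {w \<in> permutations_of_set (insert m A). P w}"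
    then have "y \<in> ?f ` ?X" using X by simp
    then obtain w p where wp: "w \<in> permutations_of_set A" "p \<le> card A" "y = ?f (w, p)"
      by auto
    then have "(w, p) \<in> ?D"
      using y PS[of w p] by simp
    then show "y \<in> ?f ` ?D"
      using wp(3) by blast
  qed
  then have "bij_betw ?f ?D {w \<in> permutations_of_set (insert m A). P w}"
    by (intro bij_betw_subset[OF bij_betw_insert_at[OF assms(1,2)]]) auto
  from sum.reindex_bij_betw[OF this, of f]
  have "(\<Sum>w \<in> {w \<in> permutations_of_set (insert m A). P w}. f w) = (\<Sum>(w, p) \<in> ?D. f (insert_at m p w))"
    by (simp add: case_prod_unfold)
  also have "\<dots> = (\<Sum>w \<in> {w \<in> permutations_of_set A. P w}. \<Sum>p \<in> {p. p \<le> card A \<and> S w p}. f (insert_at m p w))"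
    by (rule sum.Sigma [symmetric]) auto
  finally show ?thesis .
qed

section \<open>Insertion of a new minimum: avoidance of 3412 and 3-4-21\<close>

primrec before :: "'a list \<Rightarrow> 'a \<Rightarrow> 'a \<Rightarrow> bool" where
  "before [] x y \<longleftrightarrow> False"
| "before (a # w) x y \<longleftrightarrow> a = x \<and> y \<in> set w \<or> before w x y"

lemma before_append: "before (u @ v) x y \<longleftrightarrow> before u x y \<or> x \<in> set u \<and> y \<in> set v \<or> before v x y"
  by (induction u) auto

lemma before_in_set: "before w x y \<Longrightarrow> x \<in> set w \<and> y \<in> set w"
  by (induction w) auto

text \<open>The letters that can play the 3 in front of some 4. The letter playing the 4 can be
  forgotten, since 1 and 2 need only be compared with the 3.\<close>

definition ascent_bottoms :: "'a::linorder list \<Rightarrow> 'a set" where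
  "ascent_bottoms w = {c. \<exists>z>c. before w c z}"

lemma ascent_bottoms_Nil [simp]: "ascent_bottoms [] = {}"
  by (simp add: ascent_bottoms_def)

lemma ascent_bottoms_single [simp]: "ascent_bottoms [a] = {}"
  by (simp add: ascent_bottoms_def)

lemma ascent_bottoms_append: "ascent_bottoms u \<subseteq> ascent_bottoms (u @ v)"
  by (auto simp: ascent_bottoms_def before_append)

lemma ascent_bottoms_subset: "ascent_bottoms u \<subseteq> set u"
  by (auto simp: ascent_bottoms_def dest: before_in_set)

lemma ascent_bottoms_insert_min:
  assumes "\<And>x. x \<in> set (u @ v) \<Longrightarrow> m < x"
  shows "ascent_bottoms (u @ m # v) = ascent_bottoms (u @ v) \<union> (if v = [] then {} else {m})"
proof -
  have m: "c < z \<Longrightarrow> before (u @ m # v) c z \<longleftrightarrow> before (u @ v) c z \<or> c = m \<and> z \<in> set v" for c z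
    using assms[of c] by (auto simp: before_append)
  have "v \<noteq> [] \<longleftrightarrow> (\<exists>z>m. z \<in> set v)"
    using assms by (cases v) auto
  then show ?thesis
    unfolding ascent_bottoms_def by (auto simp: m cong: conj_cong)
qed

(* Avoidance of 3412 and 3-4-21, read off at the letter a playing the role of 1. *)
definition sis_split :: "'a::linorder list \<Rightarrow> 'a \<Rightarrow> 'a list \<Rightarrow> bool" where
  "sis_split u a v \<longleftrightarrow> (\<forall>c \<in> ascent_bottoms u. \<forall>x \<in> insert (last u) (set v). \<not> (a < x \<and> x < c))"

definition sis_avoids :: "'a::linorder list \<Rightarrow> bool" where
  "sis_avoids w \<longleftrightarrow> (\<forall>u a v. w = u @ a # v \<longrightarrow> sis_split u a v)"

definition sis_active :: "'a::linorder list \<Rightarrow> 'a list \<Rightarrow> bool" where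
  "sis_active u v \<longleftrightarrow> (\<forall>c \<in> ascent_bottoms u. \<forall>x \<in> insert (last u) (set v). c \<le> x)"

lemma append_eq_append_Cons:
  "u @ v = u' @ a # v' \<longleftrightarrow> (\<exists>u2. u = u' @ a # u2 \<and> v' = u2 @ v) \<or> (\<exists>v1. u' = u @ v1 \<and> v = v1 @ a # v')"
proof
  assume "u @ v = u' @ a # v'"
  then obtain us where "u = u' @ us \<and> us @ v = a # v' \<or> u @ us = u' \<and> v = us @ a # v'"
    unfolding append_eq_append_conv2 by blast
  then show "(\<exists>u2. u = u' @ a # u2 \<and> v' = u2 @ v) \<or> (\<exists>v1. u' = u @ v1 \<and> v = v1 @ a # v')"
    by (cases us) auto
qed auto

lemma append_Cons_eq_append_Cons:
  "u @ m # v = u' @ a # v' \<longleftrightarrow> u' = u \<and> a = m \<and> v' = v \<or> (\<exists>u2. u = u' @ a # u2 \<and> v' = u2 @ m # v)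
     \<or> (\<exists>v1. u' = u @ m # v1 \<and> v = v1 @ a # v')"
proof
  assume "u @ m # v = u' @ a # v'"
  then consider u2 where "u = u' @ a # u2" "v' = u2 @ m # v" | v1 where "u' = u @ v1" "m # v = v1 @ a # v'"
    unfolding append_eq_append_Cons by blast
  then show "u' = u \<and> a = m \<and> v' = v \<or> (\<exists>u2. u = u' @ a # u2 \<and> v' = u2 @ m # v)
     \<or> (\<exists>v1. u' = u @ m # v1 \<and> v = v1 @ a # v')"
  proof cases
    case 2
    then show ?thesis by (cases v1) auto
  qed blast
qed auto

text \<open>A new minimum can only play the 1, which is what activity excludes. It is too small to
  be the 2 or the 3 above an old 1, so old occurrences can change only through lost
  adjacency.\<close>

lemma sis_avoids_insert_min:
  assumes m: "\<And>x. x \<in> set (u @ v) \<Longrightarrow> m < x"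
  shows "sis_avoids (u @ m # v) \<longleftrightarrow> sis_avoids (u @ v) \<and> sis_active u v"
proof -
  \<comment> \<open>For empty \<open>u\<close> the letter \<open>last u\<close> is unspecified, but
    then there is no ascent bottom to compare it with.\<close>
  have asc: "ascent_bottoms u = {} \<or> u \<noteq> []" by auto
  have 1: "sis_split u m v \<longleftrightarrow> sis_active u v"
  proof -
    have "m < x" if "x \<in> insert (last u) (set v)" "c \<in> ascent_bottoms u" for x c
      using m that asc by auto
    then show ?thesis
      by (auto simp: sis_split_def sis_active_def not_less)
  qed
  have 2: "sis_split u1 a (u2 @ m # v) \<longleftrightarrow> sis_split u1 a (u2 @ v)" if "u = u1 @ a # u2" for u1 a u2
    using m[of a] that by (auto simp: sis_split_def)
  \<comment> \<open>If \<open>v1\<close> is empty, \<open>m\<close> separates \<open>last u\<close>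
    from \<open>a\<close> and could destroy an occurrence of 3-4-21. Activity already forbids
    \<open>last u\<close> to lie below an ascent bottom, so nothing is lost.\<close>
  have 3: "sis_split (u @ m # v1) a v2 \<longleftrightarrow> sis_split (u @ v1) a v2"
    if "sis_active u v" "v = v1 @ a # v2" for v1 a v2
  proof (cases "v1 = []")
    case True
    then have "ascent_bottoms (u @ m # v1) = ascent_bottoms u"
      using ascent_bottoms_insert_min[of u v1 m] m that by auto
    then show ?thesis
      using that m[of a] True by (fastforce simp: sis_split_def sis_active_def)
  next
    case False
    then have "ascent_bottoms (u @ m # v1) = insert m (ascent_bottoms (u @ v1))"
      using ascent_bottoms_insert_min[of u v1 m] m that by auto
    then show ?thesis
      using False m that by (fastforce simp: sis_split_def)
  qed
  have "sis_avoids (u @ m # v) \<longleftrightarrow> sis_split u m v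
      \<and> (\<forall>u1 a u2. u = u1 @ a # u2 \<longrightarrow> sis_split u1 a (u2 @ m # v))
      \<and> (\<forall>v1 a v2. v = v1 @ a # v2 \<longrightarrow> sis_split (u @ m # v1) a v2)"
    unfolding sis_avoids_def append_Cons_eq_append_Cons by auto
  moreover have "sis_avoids (u @ v) \<longleftrightarrow> (\<forall>u1 a u2. u = u1 @ a # u2 \<longrightarrow> sis_split u1 a (u2 @ v))
      \<and> (\<forall>v1 a v2. v = v1 @ a # v2 \<longrightarrow> sis_split (u @ v1) a v2)"
    unfolding sis_avoids_def append_eq_append_Cons by auto
  ultimately show ?thesis
    using 1 2 3 by metis
qed

definition dec_sites :: "'a::linorder list \<Rightarrow> nat set" where
  "dec_sites w = {p. p \<le> length w \<and> ascent_bottoms (take p w) = {}}"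

definition late_sites :: "'a::linorder list \<Rightarrow> nat set" where
  "late_sites w = {p. p \<le> length w \<and> sis_active (take p w) (drop p w) \<and> ascent_bottoms (take p w) \<noteq> {}}"

lemma active_sites: "{p. p \<le> length w \<and> sis_active (take p w) (drop p w)} = dec_sites w \<union> late_sites w"
  by (auto simp: dec_sites_def late_sites_def sis_active_def)

lemma finite_sites [simp]: "finite (dec_sites w)" "finite (late_sites w)"
  by (simp_all add: dec_sites_def late_sites_def)

text \<open>The set is closed downwards and contains 0 and 1, so its cardinality is at least 2 and
  the truncated subtraction that defines the first label is exact.\<close>

lemma dec_sites_eq_atMost:
  assumes "w \<noteq> []"
  shows "dec_sites w = {..Suc (card (dec_sites w) - 2)}" 
proof -
  have down: "p \<in> dec_sites w" if "q \<in> dec_sites w" "p \<le> q" for p q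
  proof -
    have "take q w = take p w @ take (q - p) (drop p w)"
      using that(2) by (metis le_add_diff_inverse take_add)
    then show ?thesis
      using that ascent_bottoms_append[of "take p w" "take (q - p) (drop p w)"] by (auto simp: dec_sites_def)
  qed
  have 1: "1 \<in> dec_sites w"
    using assms by (cases w) (auto simp: dec_sites_def)
  define d where "d = Max (dec_sites w)"
  have d: "d \<in> dec_sites w"
    unfolding d_def using 1 by (intro Max_in) auto
  have le: "p \<le> d" if "p \<in> dec_sites w" for p
    unfolding d_def using that by simp
  have "p \<in> dec_sites w \<longleftrightarrow> p \<le> d" for p
    using le[of p] down[OF d, of p] by blast
  then have D: "dec_sites w = {..d}"
    by blast
  moreover have "1 \<le> d"
    using le[OF 1] .
  ultimately show ?thesis
    unfolding D by simp
qed

lemma take_insert_at: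
  "q \<le> p \<Longrightarrow> p \<le> length w \<Longrightarrow> take q (insert_at m p w) = take q w"
  "p \<le> q \<Longrightarrow> p \<le> length w \<Longrightarrow> take (Suc q) (insert_at m p w) = take p w @ m # take (q - p) (drop p w)"
  "p \<le> q \<Longrightarrow> p \<le> length w \<Longrightarrow> drop (Suc q) (insert_at m p w) = drop q w"
  "q \<le> p \<Longrightarrow> p \<le> length w \<Longrightarrow> set (drop q (insert_at m p w)) = insert m (set (drop q w))"
proof -
  assume "q \<le> p" "p \<le> length w"
  then show "set (drop q (insert_at m p w)) = insert m (set (drop q w))"
  proof -
    have "drop q w = drop q (take p w @ drop p w)" by simp
    also have "\<dots> = drop q (take p w) @ drop p w"
      using \<open>q \<le> p\<close> \<open>p \<le> length w\<close> by (simp only: drop_append) simp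
    finally have "set (drop q w) = set (drop q (take p w)) \<union> set (drop p w)"
      by (metis set_append)
    then show ?thesis
      using \<open>q \<le> p\<close> \<open>p \<le> length w\<close> by (auto simp: insert_at_def)
  qed
qed (auto simp: insert_at_def min_def Suc_diff_le)

context
  fixes w :: "'a::linorder list" and m :: 'a and p :: nat
  assumes m: "\<And>x. x \<in> set w \<Longrightarrow> m < x" and p: "p \<le> length w"
begin

lemma ascent_bottoms_take_Suc:
  assumes "p \<le> q" "q \<le> length w"
  shows "ascent_bottoms (take (Suc q) (insert_at m p w)) = ascent_bottoms (take q w) \<union> (if q = p then {} else {m})"
proof -
  have e: "take q w = take p w @ take (q - p) (drop p w)"
    using assms by (metis le_add_diff_inverse take_add)
  show ?thesis
    unfolding take_insert_at(2)[OF assms(1) p]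
    by (subst ascent_bottoms_insert_min) (use m assms in \<open>auto simp: e dest: in_set_takeD in_set_dropD\<close>)
qed

lemma dec_sites_insert_at:
  "dec_sites (insert_at m p w) = {q \<in> dec_sites w. q \<le> p} \<union> (if p \<in> dec_sites w then {Suc p} else {})"
proof -
  have len: "length (insert_at m p w) = Suc (length w)"
    using p by (simp add: insert_at_def)
  have "q \<in> dec_sites (insert_at m p w) \<longleftrightarrow>
      q \<in> {q \<in> dec_sites w. q \<le> p} \<union> (if p \<in> dec_sites w then {Suc p} else {})" for q
  proof (cases "q \<le> p")
    case True
    then show ?thesis using p by (auto simp: dec_sites_def len take_insert_at)
  next
    case False
    then obtain q' where q: "q = Suc q'" "p \<le> q'"
      by (metis Suc_le_D not_less_eq_eq)
    then show ?thesis
      using p ascent_bottoms_take_Suc[of q'] by (auto simp: dec_sites_def len)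
  qed
  then show ?thesis by blast
qed

text \<open>A late site left of \<open>m\<close>, or directly after it, dies because
  \<open>m\<close> lies below an existing ascent bottom. Active sites further right survive, shifted
  by one, and all of them are late now: \<open>m\<close> has become an ascent bottom, but one below
  every letter, so it imposes no condition.\<close>

lemma late_sites_insert_at:
  "late_sites (insert_at m p w) = Suc ` {q \<in> dec_sites w \<union> late_sites w. p < q}"
proof -
  have len: "length (insert_at m p w) = Suc (length w)"
    using p by (simp add: insert_at_def)
  have "q \<in> late_sites (insert_at m p w) \<longleftrightarrow> q \<in> Suc ` {q \<in> dec_sites w \<union> late_sites w. p < q}" for q
  proof (cases "q \<le> p")
    case True
    have "\<not> sis_active (take q w) (drop q (insert_at m p w))" if "c \<in> ascent_bottoms (take q w)" for c
    proof -
      have "m < c" using m that ascent_bottoms_subset by (metis in_set_takeD subsetD)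
      with that show ?thesis
        unfolding sis_active_def take_insert_at(4)[OF True p] by (meson insertI1 insertI2 leD)
    qed
    then show ?thesis using True p by (auto simp: late_sites_def take_insert_at)
  next
    case False
    then obtain q' where q: "q = Suc q'" "p \<le> q'"
      by (metis Suc_le_D not_less_eq_eq)
    show ?thesis
    proof (cases "q' = p")
      case True
      have "\<not> sis_active (take q (insert_at m p w)) (drop q (insert_at m p w))" 
        if "c \<in> ascent_bottoms (take p w)" for c
      proof -
        have "m < c" using m that ascent_bottoms_subset by (metis in_set_takeD subsetD)
        moreover have "last (take q (insert_at m p w)) = m"
          unfolding q(1) True take_insert_at(2)[OF order.refl p] by simp
        moreover have "c \<in> ascent_bottoms (take q (insert_at m p w))"
          using that ascent_bottoms_take_Suc[of p] p q True by simp
        ultimately show ?thesis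
          unfolding sis_active_def by (metis insertI1 leD)
      qed
      then show ?thesis
        using q True p ascent_bottoms_take_Suc[of p] by (auto simp: late_sites_def)
    next
      case F: False
      show ?thesis
      proof (cases "q' \<le> length w")
        case True
        have "take q' w = take p w @ take (q' - p) (drop p w)"
          using q by (metis le_add_diff_inverse take_add)
        moreover have "take (q' - p) (drop p w) \<noteq> []"
          using q F True by simp
        ultimately have "last (take q (insert_at m p w)) = last (take q' w)"
          unfolding q(1) take_insert_at(2)[OF q(2) p] by simp
        moreover have "last (take q' w) \<in> set w"
          using F q True by (metis in_set_takeD last_in_set le_zero_eq length_0_conv take_eq_Nil)
        moreover have "ascent_bottoms (take q (insert_at m p w)) = insert m (ascent_bottoms (take q' w))"
          using ascent_bottoms_take_Suc[of q'] q True F by simp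
        moreover have "m < x" if "x \<in> set (drop q' w)" for x
          using that m by (meson in_set_dropD)
        ultimately have "sis_active (take q (insert_at m p w)) (drop q (insert_at m p w)) \<longleftrightarrow>
            sis_active (take q' w) (drop q' w)"
          using m unfolding q(1) take_insert_at(3)[OF q(2) p]
          by (auto simp: sis_active_def less_imp_le)
        moreover have "ascent_bottoms (take q (insert_at m p w)) \<noteq> {}"
          using ascent_bottoms_take_Suc[of q'] q True F by simp
        ultimately show ?thesis
          using q F True active_sites[of w] by (auto simp: late_sites_def len)
      qed (use q F in \<open>auto simp: late_sites_def dec_sites_def len\<close>)
    qed
  qed
  then show ?thesis by blast
qed

end

lemma sum_card_greater:
  fixes E :: "nat set"
  assumes "finite E"
  shows "(\<Sum>x\<in>E. f (card {q \<in> E. x < q})) = (\<Sum>j<card E. f j)"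
  using assms
proof (induction E rule: finite_linorder_min_induct)
  case (insert b E)
  have b: "b \<notin> E" using insert.hyps(2) by blast
  have "{q \<in> insert b E. b < q} = E"
    using insert.hyps(2) by auto
  moreover have "{q \<in> insert b E. x < q} = {q \<in> E. x < q}" if "x \<in> E" for x
    using insert.hyps(2) that by fastforce
  ultimately show ?case
    using insert b by (simp add: add.commute)
qed simp

lemma sum_card_less:
  fixes E :: "nat set"
  assumes "finite E"
  shows "(\<Sum>x\<in>E. f (card {q \<in> E. q < x})) = (\<Sum>j<card E. f j)"
  using assms
proof (induction E rule: finite_linorder_max_induct)
  case (insert b E)
  have b: "b \<notin> E" using insert.hyps(2) by blast
  have "{q \<in> insert b E. q < b} = E"
    using insert.hyps(2) by auto
  moreover have "{q \<in> insert b E. q < x} = {q \<in> E. q < x}" if "x \<in> E" for x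
    using insert.hyps(2) that by fastforce
  ultimately show ?case
    using insert b by (simp add: add.commute)
qed simp

definition sis_label :: "(nat \<Rightarrow> nat \<Rightarrow> 'b) \<Rightarrow> 'a::linorder list \<Rightarrow> 'b" where
  "sis_label g w = g (card (dec_sites w) - 2) (card (late_sites w))"

text \<open>Insertion at a site \<open>p\<close> with decreasing prefix leaves the decreasing sites
  \<open>0..p+1\<close> and turns the remaining \<open>Suc a - p\<close> into late ones. Insertion
  at a late site keeps the first label and retains only the late sites to its right.\<close>

lemma sis_label_children:
  fixes g :: "nat \<Rightarrow> nat \<Rightarrow> 'b::comm_monoid_add"
  assumes w: "w \<noteq> []" and m: "\<And>x. x \<in> set w \<Longrightarrow> m < x"
  defines "a \<equiv> card (dec_sites w) - 2" and "k \<equiv> card (late_sites w)"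
  shows "(\<Sum>p \<in> dec_sites w \<union> late_sites w. sis_label g (insert_at m p w)) =
           (\<Sum>p\<le>Suc a. g p (Suc a - p + k)) + (\<Sum>j<k. g a j)"
proof -
  have dec: "dec_sites w = {..Suc a}"
    unfolding a_def by (rule dec_sites_eq_atMost) fact
  have disj: "dec_sites w \<inter> late_sites w = {}"
    by (auto simp: dec_sites_def late_sites_def)
  have late: "Suc a < q" if "q \<in> late_sites w" for q
    using disj that unfolding dec by (metis atMost_iff disjoint_iff not_less)
  have len: "p \<le> length w" if "p \<in> dec_sites w \<union> late_sites w" for p
    using that by (auto simp: dec_sites_def late_sites_def)
  have 1: "sis_label g (insert_at m p w) = g p (Suc a - p + k)" if p: "p \<in> dec_sites w" for p
  proof -
    have pa: "p \<le> Suc a" using p dec by simp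
    have "dec_sites (insert_at m p w) = {q \<in> dec_sites w. q \<le> p} \<union> {Suc p}"
      using p by (subst dec_sites_insert_at[OF m len]) auto
    also have "\<dots> = {..Suc p}"
      unfolding dec using pa by auto
    finally have "dec_sites (insert_at m p w) = {..Suc p}" .
    moreover have "late_sites (insert_at m p w) = Suc ` ({p<..Suc a} \<union> late_sites w)"
    proof -
      have "p < q" if "q \<in> late_sites w" for q
        using late[OF that] pa by simp
      then have "{q \<in> dec_sites w \<union> late_sites w. p < q} = {p<..Suc a} \<union> late_sites w"
        unfolding dec by auto
      then show ?thesis
        using p by (subst late_sites_insert_at[OF m len]) auto
    qed
    moreover have "card ({p<..Suc a} \<union> late_sites w) = Suc a - p + k"
      unfolding k_def by (subst card_Un_disjoint) (auto dest: late)
    ultimately show ?thesis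
      by (simp add: sis_label_def card_image del: image_Un)
  qed
  have 2: "sis_label g (insert_at m p w) = g a (card {q \<in> late_sites w. p < q})" if p: "p \<in> late_sites w" for p
  proof -
    have pa: "Suc a < p" using p by (rule late)
    have "dec_sites (insert_at m p w) = {q \<in> dec_sites w. q \<le> p}"
      using p disj by (subst dec_sites_insert_at[OF m len]) auto
    also have "\<dots> = dec_sites w"
      unfolding dec using pa by auto
    finally have "dec_sites (insert_at m p w) = dec_sites w" .
    moreover have "late_sites (insert_at m p w) = Suc ` {q \<in> late_sites w. p < q}"
    proof -
      have "{q \<in> dec_sites w \<union> late_sites w. p < q} = {q \<in> late_sites w. p < q}"
        unfolding dec using pa by auto
      then show ?thesis
        using p by (subst late_sites_insert_at[OF m len]) auto
    qed
    ultimately show ?thesis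
      by (simp add: sis_label_def card_image a_def)
  qed
  have "(\<Sum>p \<in> dec_sites w \<union> late_sites w. sis_label g (insert_at m p w)) =
      (\<Sum>p\<in>dec_sites w. g p (Suc a - p + k)) + (\<Sum>p\<in>late_sites w. g a (card {q \<in> late_sites w. p < q}))"
    using disj 1 2 by (subst sum.union_disjoint) auto
  also have "(\<Sum>p\<in>late_sites w. g a (card {q \<in> late_sites w. p < q})) = (\<Sum>j<k. g a j)"
    unfolding k_def by (rule sum_card_greater) simp
  finally show ?thesis
    unfolding dec .
qed

text \<open>The words use the top \<open>Suc n\<close> letters below a fixed \<open>N\<close>, so
  that new minima can be inserted into words of naturals without renumbering.\<close>

lemma sis_label_sum:
  fixes x y z :: "'b::field"
  assumes nz: "x \<noteq> 0" "y \<noteq> 0" "z \<noteq> 0" "x + y \<noteq> 0" "x + z \<noteq> 0" "y + z \<noteq> 0" "x + y + z \<noteq> 0"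
    and "n < N"
  shows "(\<Sum>w \<in> {w \<in> permutations_of_set {N - Suc n<..N}. sis_avoids w}. sis_label (sis_orbit x y z) w) =
           hex_kernel x y z ^ n * sis_orbit x y z 0 0"
  using assms(8)
proof (induction n)
  case 0
  then have "{N - Suc 0<..N} = {N}" by auto
  moreover have "sis_avoids [N]"
    by (auto simp: sis_avoids_def sis_split_def Cons_eq_append_conv)
  moreover have "dec_sites [N] = {..1}" "late_sites [N] = {}"
    by (auto simp: dec_sites_def late_sites_def take_Cons' le_Suc_eq)
  ultimately show ?case
    by (simp add: sis_label_def conj_commute cong: conj_cong)
next
  case (Suc n)
  define A where "A = {N - Suc n<..N}"
  define m where "m = N - Suc n"
  have A: "{N - Suc (Suc n)<..N} = insert m A"
    using Suc.prems by (auto simp: A_def m_def)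
  have m: "m < x" if "x \<in> A" for x
    using that by (simp add: A_def m_def)
  have "(\<Sum>w \<in> {w \<in> permutations_of_set (insert m A). sis_avoids w}. sis_label (sis_orbit x y z) w) =
      (\<Sum>w \<in> {w \<in> permutations_of_set A. sis_avoids w}.
        \<Sum>p \<in> {p. p \<le> card A \<and> sis_active (take p w) (drop p w)}. sis_label (sis_orbit x y z) (insert_at m p w))"
  proof (rule sum_permutations_insert)
    fix w p assume "w \<in> permutations_of_set A"
    then show "sis_avoids (insert_at m p w) \<longleftrightarrow> sis_avoids w \<and> sis_active (take p w) (drop p w)"
      using sis_avoids_insert_min[of "take p w" "drop p w" m] m
      by (simp add: insert_at_def permutations_of_set_def)
  qed (use m in \<open>auto simp: A_def\<close>)
  also have "\<dots> = (\<Sum>w \<in> {w \<in> permutations_of_set A. sis_avoids w}. hex_kernel x y z * sis_label (sis_orbit x y z) w)"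
  proof (rule sum.cong [OF refl])
    fix w assume "w \<in> {w \<in> permutations_of_set A. sis_avoids w}"
    then have w: "set w = A" "length w = card A"
      by (auto simp: permutations_of_set_def distinct_card)
    then have "w \<noteq> []" using Suc.prems by (auto simp: A_def)
    have "{p. p \<le> card A \<and> sis_active (take p w) (drop p w)} = dec_sites w \<union> late_sites w"
      using active_sites[of w] w by simp
    then show "(\<Sum>p \<in> {p. p \<le> card A \<and> sis_active (take p w) (drop p w)}. sis_label (sis_orbit x y z) (insert_at m p w))
       = hex_kernel x y z * sis_label (sis_orbit x y z) w"
      using sis_label_children[OF \<open>w \<noteq> []\<close>, of m "sis_orbit x y z"] m w sis_orbit_children[OF nz]
      by (simp add: sis_label_def)
  qed
  also have "\<dots> = hex_kernel x y z ^ Suc n * sis_orbit x y z 0 0"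
    using Suc by (simp add: A_def mult.assoc flip: sum_distrib_left)
  finally show ?case unfolding A .
qed

lemma card_sis_avoids:
  "real (card {w \<in> permutations_of_set {1..Suc m}. sis_avoids w}) = bax_total m"
proof -
  let ?W = "{w \<in> permutations_of_set {Suc m - Suc m<..Suc m}. sis_avoids w}"
  have "(\<Sum>w \<in> ?W. sis_label (sis_orbit \<alpha> 1 \<gamma>) w) = hex_kernel \<alpha> 1 \<gamma> ^ m * sis_orbit \<alpha> 1 \<gamma> 0 0"
    by (rule sis_label_sum) (simp_all add: sums_nonzero)
  then have "co (\<Sum>w \<in> ?W. sis_label (sis_orbit \<alpha> 1 \<gamma>) w) (-2) 1 = bax_total m"
    by (simp add: co_kernel_sis_orbit_root)
  moreover have "{Suc m - Suc m<..Suc m} = {1..Suc m}"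
    by auto
  ultimately show ?thesis
    by (simp add: co_sum sis_label_def co_sis_orbit)
qed

section \<open>Insertion of a new maximum: Baxter permutations\<close>

definition bax_avoids :: "'a::linorder list \<Rightarrow> bool" where
  "bax_avoids w \<longleftrightarrow> (\<forall>u x y v. w = u @ x # y # v \<longrightarrow>
     (\<forall>s \<in> set u. \<forall>t \<in> set v. \<not> (y < s \<and> s < t \<and> t < x) \<and> \<not> (x < t \<and> t < s \<and> s < y)))"

lemma bax_avoidsD:
  "bax_avoids (u @ x # y # v) \<Longrightarrow> s \<in> set u \<Longrightarrow> t \<in> set v \<Longrightarrow>
     \<not> (y < s \<and> s < t \<and> t < x) \<and> \<not> (x < t \<and> t < s \<and> s < y)"
  by (auto simp: bax_avoids_def)

definition bax_active :: "'a::linorder list \<Rightarrow> 'a list \<Rightarrow> bool" where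
  "bax_active u v \<longleftrightarrow> u = [] \<or> v = [] \<or> (\<forall>s \<in> set u. s < hd v) \<or> (\<forall>t \<in> set v. t < last u)"

text \<open>The maximum can only play the 4. If the site is not active, the letters
  \<open>x\<close>, \<open>y\<close> around \<open>M\<close> complete a pattern: 3-14-2 if
  \<open>x < y\<close>, otherwise 2-41-3. Conversely, at an active site an occurrence using
  \<open>M\<close> is transferred to the letter on the other side of \<open>M\<close>, giving one in
  \<open>u @ v\<close>. An old occurrence whose adjacent pair is split by \<open>M\<close> survives
  with \<open>M\<close> as its 4.\<close>

lemma bax_avoids_insert_max:
  assumes M: "\<And>x. x \<in> set (u @ v) \<Longrightarrow> x < M" and d: "distinct (u @ v)"
  shows "bax_avoids (u @ M # v) \<longleftrightarrow> bax_avoids (u @ v) \<and> bax_active u v"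
proof (intro iffI conjI)
  assume av: "bax_avoids (u @ M # v)"
  show "bax_avoids (u @ v)"
    unfolding bax_avoids_def
  proof (intro allI impI ballI)
    fix u1 x y v1 s t
    assume e: "u @ v = u1 @ x # y # v1" and st: "s \<in> set u1" "t \<in> set v1"
    have "x < M" "y < M" "s < M" "t < M" using e st M by auto
    from e consider u2 where "u = u1 @ x # u2" "y # v1 = u2 @ v" | v2 where "u1 = u @ v2" "v = v2 @ x # y # v1"
      unfolding append_eq_append_Cons by blast
    then show "\<not> (y < s \<and> s < t \<and> t < x) \<and> \<not> (x < t \<and> t < s \<and> s < y)"
    proof cases
      case 1
      show ?thesis
      proof (cases u2)
        case Nil
        then have "u @ M # v = u1 @ x # M # (y # v1)" "u @ M # v = (u1 @ [x]) @ M # y # v1"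
          using 1 by simp_all
        then have "\<not> (x < t \<and> t < s \<and> s < M)" "\<not> (y < s \<and> s < t \<and> t < M)"
          using bax_avoidsD[of u1 x M "y # v1" s t] bax_avoidsD[of "u1 @ [x]" M y v1 s t] av st by auto
        then show ?thesis using \<open>s < M\<close> \<open>t < M\<close> by blast
      next
        case (Cons _ u3)
        then have "u @ M # v = u1 @ x # y # (u3 @ M # v)" "t \<in> set (u3 @ M # v)"
          using 1 st by auto
        then show ?thesis
          using bax_avoidsD[of u1 x y "u3 @ M # v" s t] av st by simp
      qed
    next
      case 2
      then have "u @ M # v = (u @ M # v2) @ x # y # v1" "s \<in> set (u @ M # v2)"
        using st by auto
      then show ?thesis
        using bax_avoidsD[of "u @ M # v2" x y v1 s t] av st by simp
    qed
  qed
  show "bax_active u v"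
  proof (rule ccontr)
    assume na: "\<not> bax_active u v"
    then have "u \<noteq> []" "v \<noteq> []" by (auto simp: bax_active_def)
    then obtain u' x y v' where uv: "u = u' @ [x]" "v = y # v'"
      by (metis list.exhaust rev_exhaust)
    from na obtain s t where st: "s \<in> set u" "\<not> s < y" "t \<in> set v" "\<not> t < x"
      by (auto simp: bax_active_def uv)
    have ne: "s \<noteq> y" "t \<noteq> x" "x \<noteq> y"
      using d st uv by auto
    show False
    proof (cases "x < y")
      case True
      then have "s \<in> set u'" using st uv by auto
      then show False
        using bax_avoidsD[of u' x M v s y] av True st ne M[of s] uv by auto
    next
      case False
      then have "t \<in> set v'" using st uv ne by auto
      then show False
        using bax_avoidsD[of u M y v' x t] av False st ne M[of t] uv by auto
    qed
  qed
next
  assume "bax_avoids (u @ v) \<and> bax_active u v"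
  then have av: "bax_avoids (u @ v)" and ac: "bax_active u v" by blast+
  show "bax_avoids (u @ M # v)"
    unfolding bax_avoids_def
  proof (intro allI impI ballI)
    fix u1 x y v1 s t
    assume e: "u @ M # v = u1 @ x # y # v1" and st: "s \<in> set u1" "t \<in> set v1"
    have le: "z \<le> M" if "z \<in> set (u1 @ x # y # v1)" for z
      using that M unfolding e[symmetric] by (auto intro: less_imp_le)
    have leM: "x \<le> M" "y \<le> M" "s \<le> M" "t \<le> M"
      using le st by auto
    from e consider "u1 = u" "x = M" "v = y # v1" | u2 where "u = u1 @ x # u2" "y # v1 = u2 @ M # v"
      | w1 where "u1 = u @ M # w1" "v = w1 @ x # y # v1"
      unfolding append_Cons_eq_append_Cons by blast
    then show "\<not> (y < s \<and> s < t \<and> t < x) \<and> \<not> (x < t \<and> t < s \<and> s < y)"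
    proof cases
      case 1
      have False if ord: "y < s" "s < t"
      proof -
        obtain u' z where u: "u = u' @ [z]"
          using st(1) 1(1) by (metis empty_iff empty_set rev_exhaust)
        from ac have "t < z"
          using st 1 ord by (auto simp: bax_active_def u)
        then have "s \<in> set u'" using st 1 u ord by auto
        then show False
          using bax_avoidsD[of u' z y v1 s t] av 1 u st ord \<open>t < z\<close> by auto
      qed
      then show ?thesis using leM 1 by auto
    next
      case 2
      show ?thesis
      proof (cases u2)
        case Nil
        have False if ord: "x < t" "t < s"
        proof -
          obtain h v' where v: "v = h # v'"
            using st(2) 2 Nil by (cases v) auto
          from ac have "s < h"
            using st 2 ord Nil by (auto simp: bax_active_def v)
          then have "t \<in> set v'" using st 2 v ord Nil by auto
          then show False
            using bax_avoidsD[of u1 x h v' s t] av 2 v st ord Nil \<open>s < h\<close> by auto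
        qed
        then show ?thesis using leM 2 Nil by auto
      next
        case (Cons _ u3)
        then have "v1 = u3 @ M # v" "u = u1 @ x # y # u3" using 2 by auto
        then show ?thesis
          using bax_avoidsD[of u1 x y "u3 @ v" s t] av st leM by auto
      qed
    next
      case 3
      then show ?thesis
        using bax_avoidsD[of "u @ w1" x y v1 s t] av st leM by auto
    qed
  qed
qed

definition lr_sites :: "'a::linorder list \<Rightarrow> nat set" where
  "lr_sites w = {p. p < length w \<and> (\<forall>s \<in> set (take p w). s < w ! p)}"

definition rl_sites :: "'a::linorder list \<Rightarrow> nat set" where
  "rl_sites w = {p. 0 < p \<and> p \<le> length w \<and> (\<forall>t \<in> set (drop p w). t < w ! (p - 1))}"

lemma finite_bax_sites [simp]: "finite (lr_sites w)" "finite (rl_sites w)"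
  by (simp_all add: lr_sites_def rl_sites_def)

lemma bax_active_sites:
  assumes "w \<noteq> []"
  shows "{p. p \<le> length w \<and> bax_active (take p w) (drop p w)} = lr_sites w \<union> rl_sites w"
proof (intro set_eqI)
  fix p
  have "last (take p w) = w ! (p - 1)" if "0 < p" "p \<le> length w"
    using that by (subst last_conv_nth) auto
  moreover have "hd (drop p w) = w ! p" if "p < length w"
    using that by (rule hd_drop_conv_nth)
  ultimately show "p \<in> {p. p \<le> length w \<and> bax_active (take p w) (drop p w)} \<longleftrightarrow> p \<in> lr_sites w \<union> rl_sites w"
    using assms by (cases "p = 0"; cases "p = length w") (auto simp: bax_active_def lr_sites_def rl_sites_def)
qed

text \<open>If \<open>q\<close> were at most \<open>p\<close>, the right-to-left maximum before
  \<open>q\<close> would stand left of the left-to-right maximum after \<open>p\<close>, and each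
  would have to exceed the other.\<close>

lemma lr_less_rl:
  assumes "p \<in> lr_sites w" "q \<in> rl_sites w"
  shows "p < q"
proof (rule ccontr)
  assume "\<not> p < q"
  then have pq: "q \<le> p" "0 < q" "p < length w"
    using assms by (auto simp: lr_sites_def rl_sites_def)
  have "take p w ! (q - 1) \<in> set (take p w)" "drop q w ! (p - q) \<in> set (drop q w)"
    by (rule nth_mem; use pq in simp)+
  then have "w ! (q - 1) \<in> set (take p w)" "w ! p \<in> set (drop q w)"
    using pq by simp_all
  then show False
    using assms by (fastforce simp: lr_sites_def rl_sites_def)
qed

lemma nth_insert_at:
  assumes "p \<le> length w"
  shows "q < p \<Longrightarrow> insert_at m p w ! q = w ! q" "insert_at m p w ! p = m"
    "p \<le> q \<Longrightarrow> insert_at m p w ! Suc q = w ! q"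
  using assms by (auto simp: insert_at_def nth_append min_def Suc_diff_le)

text \<open>The new letter is a maximum from both sides; it hides the left-to-right maxima after it
  and the right-to-left maxima before it.\<close>

lemma bax_sites_insert_at:
  assumes M: "\<And>x. x \<in> set w \<Longrightarrow> x < M" and p: "p \<le> length w"
  shows "lr_sites (insert_at M p w) = insert p {q \<in> lr_sites w. q < p}"
    and "rl_sites (insert_at M p w) = Suc ` insert p {q \<in> rl_sites w. p < q}"
proof -
  have len: "length (insert_at M p w) = Suc (length w)"
    using p by (simp add: insert_at_def)
  show "lr_sites (insert_at M p w) = insert p {q \<in> lr_sites w. q < p}"
  proof (intro set_eqI)
    fix q
    consider "q < p" | "q = p" | q' where "q = Suc q'" "p \<le> q'"
      by (metis Suc_le_D linorder_neqE_nat not_less_eq_eq order.strict_implies_order less_eq_Suc_le)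
    then show "q \<in> lr_sites (insert_at M p w) \<longleftrightarrow> q \<in> insert p {q \<in> lr_sites w. q < p}"
    proof cases
      case 1
      then show ?thesis using p by (auto simp: lr_sites_def len take_insert_at nth_insert_at)
    next
      case 2
      then show ?thesis using p M by (auto simp: lr_sites_def len take_insert_at nth_insert_at dest: in_set_takeD)
    next
      case 3
      have "\<not> M < w ! q'" if "q' < length w"
        using M[of "w ! q'"] that by auto
      then show ?thesis using p 3 by (auto simp: lr_sites_def len take_insert_at nth_insert_at)
    qed
  qed
  show "rl_sites (insert_at M p w) = Suc ` insert p {q \<in> rl_sites w. p < q}"
  proof (intro set_eqI)
    fix q
    consider "q \<le> p" | "q = Suc p" | q' where "q = Suc q'" "p < q'"
      by (metis Suc_lessE not_less_eq_eq le_less_Suc_eq less_Suc_eq_le not_less)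
    then show "q \<in> rl_sites (insert_at M p w) \<longleftrightarrow> q \<in> Suc ` insert p {q \<in> rl_sites w. p < q}"
    proof cases
      case 1
      have "\<not> M < w ! (q - 1)" if "0 < q"
        using M[of "w ! (q - 1)"] that 1 p by (auto simp: not_less less_imp_le)
      then show ?thesis using p 1 by (auto simp: rl_sites_def len take_insert_at nth_insert_at)
    next
      case 2
      then show ?thesis using p M by (auto simp: rl_sites_def len take_insert_at nth_insert_at dest: in_set_dropD)
    next
      case 3
      then have "insert_at M p w ! q' = w ! (q' - 1)"
        using nth_insert_at(3)[OF p, of "q' - 1"] by simp
      then show ?thesis using p 3 by (auto simp: rl_sites_def len take_insert_at)
    qed
  qed
qed

definition bax_label :: "(nat \<Rightarrow> nat \<Rightarrow> 'b) \<Rightarrow> 'a::linorder list \<Rightarrow> 'b" where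
  "bax_label g w = g (card (lr_sites w) - 1) (card (rl_sites w) - 1)"

text \<open>The classical succession rule of Baxter permutations with both labels lowered by one:
  inserting before a left-to-right maximum keeps all right-to-left maxima, and vice versa.\<close>

lemma bax_label_children:
  fixes g :: "nat \<Rightarrow> nat \<Rightarrow> 'b::comm_monoid_add"
  assumes w: "w \<noteq> []" and M: "\<And>x. x \<in> set w \<Longrightarrow> x < M"
  defines "i \<equiv> card (lr_sites w) - 1" and "j \<equiv> card (rl_sites w) - 1"
  shows "(\<Sum>p \<in> lr_sites w \<union> rl_sites w. bax_label g (insert_at M p w)) =
           (\<Sum>s\<le>i. g s (Suc j)) + (\<Sum>s\<le>j. g (Suc i) s)"
proof -
  have disj: "lr_sites w \<inter> rl_sites w = {}"
    using lr_less_rl by blast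
  have "0 \<in> lr_sites w" "length w \<in> rl_sites w"
    using w by (auto simp: lr_sites_def rl_sites_def)
  then have "card (lr_sites w) > 0" "card (rl_sites w) > 0"
    by (auto simp: card_gt_0_iff)
  then have ij: "card (lr_sites w) = Suc i" "card (rl_sites w) = Suc j"
    by (simp_all add: i_def j_def)
  have len: "p \<le> length w" if "p \<in> lr_sites w \<union> rl_sites w" for p
    using that by (auto simp: lr_sites_def rl_sites_def)
  have 1: "bax_label g (insert_at M p w) = g (card {q \<in> lr_sites w. q < p}) (Suc j)" if p: "p \<in> lr_sites w" for p
  proof -
    have "{q \<in> rl_sites w. p < q} = rl_sites w"
      using lr_less_rl[OF p] by blast
    moreover have "p \<notin> rl_sites w" using disj p by blast
    ultimately show ?thesis
      using bax_sites_insert_at[of w M p, OF M len] p ij by (simp add: bax_label_def card_image[OF inj_Suc] del: image_insert)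
  qed
  have 2: "bax_label g (insert_at M p w) = g (Suc i) (card {q \<in> rl_sites w. p < q})" if p: "p \<in> rl_sites w" for p
  proof -
    have "{q \<in> lr_sites w. q < p} = lr_sites w"
      using lr_less_rl[OF _ p] by blast
    moreover have "p \<notin> lr_sites w" using disj p by blast
    ultimately show ?thesis
      using bax_sites_insert_at[of w M p, OF M len] p ij by (simp add: bax_label_def card_image[OF inj_Suc] del: image_insert)
  qed
  have "(\<Sum>p \<in> lr_sites w \<union> rl_sites w. bax_label g (insert_at M p w)) =
      (\<Sum>p\<in>lr_sites w. g (card {q \<in> lr_sites w. q < p}) (Suc j))
      + (\<Sum>p\<in>rl_sites w. g (Suc i) (card {q \<in> rl_sites w. p < q}))"
    using disj 1 2 by (subst sum.union_disjoint) auto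
  also have "(\<Sum>p\<in>lr_sites w. g (card {q \<in> lr_sites w. q < p}) (Suc j)) = (\<Sum>s\<le>i. g s (Suc j))"
    using sum_card_less[of "lr_sites w" "\<lambda>s. g s (Suc j)"] by (simp add: ij lessThan_Suc_atMost)
  also have "(\<Sum>p\<in>rl_sites w. g (Suc i) (card {q \<in> rl_sites w. p < q})) = (\<Sum>s\<le>j. g (Suc i) s)"
    using sum_card_greater[of "rl_sites w" "\<lambda>s. g (Suc i) s"] by (simp add: ij lessThan_Suc_atMost)
  finally show ?thesis .
qed

lemma bax_label_sum:
  fixes u v :: "'b::field"
  assumes nz: "u \<noteq> 0" "v \<noteq> 0"
  shows "(\<Sum>w \<in> {w \<in> permutations_of_set {1..Suc n}. bax_avoids w}. bax_label (bax_orbit u v) w) =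
           ((1 + u) * (1 + v) * (u + v) / (u * v)) ^ n * bax_orbit u v 0 0"
proof (induction n)
  case 0
  have "bax_avoids [1::nat]"
    by (auto simp: bax_avoids_def Cons_eq_append_conv)
  moreover have "lr_sites [1::nat] = {0}" "rl_sites [1::nat] = {1}"
    by (auto simp: lr_sites_def rl_sites_def)
  ultimately show ?case
    by (simp add: bax_label_def conj_commute cong: conj_cong)
next
  case (Suc n)
  define A where "A = {1..Suc n}"
  define M where "M = Suc (Suc n)"
  have A: "{1..Suc (Suc n)} = insert M A"
    by (auto simp: A_def M_def)
  have M: "x < M" if "x \<in> A" for x
    using that by (simp add: A_def M_def)
  have "(\<Sum>w \<in> {w \<in> permutations_of_set (insert M A). bax_avoids w}. bax_label (bax_orbit u v) w) =
      (\<Sum>w \<in> {w \<in> permutations_of_set A. bax_avoids w}.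
        \<Sum>p \<in> {p. p \<le> card A \<and> bax_active (take p w) (drop p w)}. bax_label (bax_orbit u v) (insert_at M p w))"
  proof (rule sum_permutations_insert)
    fix w p assume "w \<in> permutations_of_set A"
    then show "bax_avoids (insert_at M p w) \<longleftrightarrow> bax_avoids w \<and> bax_active (take p w) (drop p w)"
      using bax_avoids_insert_max[of "take p w" "drop p w" M] M
      by (simp add: insert_at_def permutations_of_set_def)
  qed (use M in \<open>auto simp: A_def\<close>)
  also have "\<dots> = (\<Sum>w \<in> {w \<in> permutations_of_set A. bax_avoids w}.
      (1 + u) * (1 + v) * (u + v) / (u * v) * bax_label (bax_orbit u v) w)"
  proof (rule sum.cong [OF refl])
    fix w assume "w \<in> {w \<in> permutations_of_set A. bax_avoids w}"
    then have w: "set w = A" "length w = card A"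
      by (auto simp: permutations_of_set_def distinct_card)
    then have "w \<noteq> []" by (auto simp: A_def)
    then have "{p. p \<le> card A \<and> bax_active (take p w) (drop p w)} = lr_sites w \<union> rl_sites w"
      using bax_active_sites[of w] w by simp
    then show "(\<Sum>p \<in> {p. p \<le> card A \<and> bax_active (take p w) (drop p w)}. bax_label (bax_orbit u v) (insert_at M p w))
       = (1 + u) * (1 + v) * (u + v) / (u * v) * bax_label (bax_orbit u v) w"
      using bax_label_children[OF \<open>w \<noteq> []\<close>, of M "bax_orbit u v"] M w bax_orbit_children[OF nz]
      by (simp add: bax_label_def)
  qed
  also have "\<dots> = ((1 + u) * (1 + v) * (u + v) / (u * v)) ^ Suc n * bax_orbit u v 0 0"
    using Suc by (simp only: A_def mult.assoc power_Suc flip: sum_distrib_left)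
  finally show ?case unfolding A .
qed

lemma card_bax_avoids:
  "real (card {w \<in> permutations_of_set {1..Suc m}. bax_avoids w}) = bax_total m"
proof -
  let ?W = "{w \<in> permutations_of_set {1..Suc m}. bax_avoids w}"
  \<comment> \<open>Inverting both variables identifies the Baxter kernel with the kernel of the
    other tree at middle variable 1.\<close>
  have K: "(1 + 1 / x) * (1 + 1 / z) * (1 / x + 1 / z) / (1 / x * (1 / z)) = hex_kernel x 1 z"
    if "x \<noteq> 0" "z \<noteq> 0" for x z :: laurent2
    using that by (simp add: hex_kernel_def field_simps)
  have "(\<Sum>w \<in> ?W. bax_label (bax_orbit (1 / \<alpha>) (1 / \<gamma>)) w) =
      hex_kernel \<alpha> 1 \<gamma> ^ m * bax_orbit (1 / \<alpha>) (1 / \<gamma>) 0 0"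
    using bax_label_sum[of "1 / \<alpha>" "1 / \<gamma>" m] unfolding K[OF al_nonzero ga_nonzero] by simp
  then have "co (\<Sum>w \<in> ?W. bax_label (bax_orbit (1 / \<alpha>) (1 / \<gamma>)) w) (-1) (-1) = bax_total m"
    by (simp add: co_kernel_bax_orbit_root)
  then show ?thesis
    by (simp add: co_sum bax_label_def co_bax_orbit)
qed

section \<open>Stack sorting and pattern avoidance\<close>

lemma before_asym: "distinct w \<Longrightarrow> before w x y \<Longrightarrow> \<not> before w y x"
  by (induction w) (auto dest: before_in_set)

lemma before_total: "x \<in> set w \<Longrightarrow> y \<in> set w \<Longrightarrow> x \<noteq> y \<Longrightarrow> before w x y \<or> before w y x"
  by (induction w) auto

text \<open>Induction along the recursion of stack sorting, with the maximum exposed instead of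
  located by \<open>takeWhile\<close>.\<close>

lemma distinct_max_induct [consumes 1, case_names Nil max]:
  assumes "distinct (w :: 'a::linorder list)"
    and "P []"
    and "\<And>L m R. distinct (L @ m # R) \<Longrightarrow> (\<And>x. x \<in> set L \<union> set R \<Longrightarrow> x < m) \<Longrightarrow> P L \<Longrightarrow> P R \<Longrightarrow> P (L @ m # R)"
  shows "P w"
  using assms(1)
proof (induction "length w" arbitrary: w rule: less_induct)
  case less
  show ?case
  proof (cases "w = []")
    case False
    then have "Max (set w) \<in> set w" by simp
    then obtain L R where w: "w = L @ Max (set w) # R"
      by (meson split_list)
    define m where "m = Max (set w)"
    have w: "w = L @ m # R" using w by (simp add: m_def)
    have "x < m" if "x \<in> set L \<union> set R" for x
    proof -
      have "x \<in> set w" "x \<noteq> m" using that less.prems by (auto simp: w)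
      then show ?thesis by (simp add: m_def less_le)
    qed
    then show ?thesis
      using less.prems less.hyps[of L] less.hyps[of R] assms(3)[of L m R] by (simp add: w)
  qed (use assms(2) in simp)
qed

lemma set_stack_sort: "distinct w \<Longrightarrow> set (stack_sort w) = set w"
  and distinct_stack_sort: "distinct w \<Longrightarrow> distinct (stack_sort w)"
proof -
  assume "distinct w"
  then have "set (stack_sort w) = set w \<and> distinct (stack_sort w)"
  proof (induction w rule: distinct_max_induct)
    case (max L m R)
    have "stack_sort (L @ m # R) = stack_sort L @ stack_sort R @ [m]"
      by (rule stack_sort_decomp) (use max.hyps(2) in blast)
    with max show ?case by auto
  qed simp
  then show "set (stack_sort w) = set w" "distinct (stack_sort w)" by simp_all
qed

text \<open>A letter leaves the stack when a larger one arrives. Thus the larger \<open>y\<close> is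
  output before the smaller \<open>x\<close> exactly if \<open>y\<close> came first and something
  larger than \<open>y\<close> arrived before \<open>x\<close>.\<close>

lemma before_stack_sort:
  assumes "distinct w" "x \<in> set w" "y \<in> set w" "x < y"
  shows "before (stack_sort w) y x \<longleftrightarrow> (\<exists>z>y. before w y z \<and> before w z x)"
  using assms
proof (induction w rule: distinct_max_induct)
  case (max L m R)
  note sets = set_stack_sort
  have d: "distinct L" "distinct R" "m \<notin> set L" "m \<notin> set R" "set L \<inter> set R = {}"
    using max.hyps(1) by auto
  have dec: "stack_sort (L @ m # R) = stack_sort L @ stack_sort R @ [m]"
    by (rule stack_sort_decomp) (use max.hyps(2) in blast)
  have xm: "x \<noteq> m"
    using max.hyps(2)[of y] max.prems by auto
  have bef: "before (L @ m # R) a b \<longleftrightarrow> before L a b \<or> a \<in> set L \<and> (b = m \<or> b \<in> set R) \<or> a = m \<and> b \<in> set R \<or> before R a b" for a b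
    by (auto simp: before_append)
  have befS: "before (stack_sort (L @ m # R)) a b \<longleftrightarrow> before (stack_sort L) a b \<or> a \<in> set L \<and> (b = m \<or> b \<in> set R)
      \<or> before (stack_sort R) a b \<or> a \<in> set R \<and> b = m" for a b
    using d unfolding dec by (auto simp: before_append sets)
  have bS: "before (stack_sort L) a b \<Longrightarrow> a \<in> set L \<and> b \<in> set L" "before (stack_sort R) a b \<Longrightarrow> a \<in> set R \<and> b \<in> set R" for a b
    using before_in_set[of "stack_sort L" a b] before_in_set[of "stack_sort R" a b] d by (auto simp: sets)
  have bL: "before L a b \<Longrightarrow> a \<in> set L \<and> b \<in> set L" "before R a b \<Longrightarrow> a \<in> set R \<and> b \<in> set R" for a b
    by (auto dest: before_in_set)
  consider "y = m" | "y \<in> set L" "x \<in> set L" | "y \<in> set R" "x \<in> set R" | "y \<in> set L" "x \<in> set R" | "y \<in> set R" "x \<in> set L"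
    using max.prems xm by auto
  then show ?case
  proof cases
    case 1
    have "\<not> z > m" if "before (L @ m # R) m z" for z
      using that d bL max.hyps(2)[of z] unfolding bef by auto
    moreover have "\<not> before (stack_sort (L @ m # R)) m x"
      using d bS xm unfolding befS by blast
    ultimately show ?thesis using 1 by blast
  next
    case 2
    have "before (stack_sort (L @ m # R)) y x \<longleftrightarrow> before (stack_sort L) y x"
      using 2 d bS xm unfolding befS by blast
    moreover have "before (L @ m # R) y z \<and> before (L @ m # R) z x \<longleftrightarrow> before L y z \<and> before L z x" for z
      using 2 d bL xm unfolding bef by blast
    ultimately show ?thesis using max.IH(1)[OF 2(2,1)] max.prems by simp
  next
    case 3
    have "before (stack_sort (L @ m # R)) y x \<longleftrightarrow> before (stack_sort R) y x"
      using 3 d bS xm unfolding befS by blast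
    moreover have "before (L @ m # R) y z \<and> before (L @ m # R) z x \<longleftrightarrow> before R y z \<and> before R z x" for z
      using 3 d bL xm unfolding bef by blast
    ultimately show ?thesis using max.IH(2)[OF 3(2,1)] max.prems by simp
  next
    \<comment> \<open>The maximum \<open>m\<close> stands between \<open>y\<close> and
      \<open>x\<close> and serves as the witness \<open>z\<close>.\<close>
    case 4
    then show ?thesis
      using max.hyps(2)[of y] unfolding befS bef by blast
  next
    case 5
    then show ?thesis
      using d bS bL xm unfolding befS bef by blast
  qed
qed simp

section \<open>Sortable words and the inverse permutation\<close>

definition avoids_231 :: "'a::linorder list \<Rightarrow> bool" where
  "avoids_231 w \<longleftrightarrow> \<not> (\<exists>a b c. a < b \<and> b < c \<and> before w b c \<and> before w c a)"

definition avoids_312 :: "'a::linorder list \<Rightarrow> bool" where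
  "avoids_312 w \<longleftrightarrow> \<not> (\<exists>a b c. a < b \<and> b < c \<and> before w c a \<and> before w a b)"

lemma sorted_iff_before: "distinct w \<Longrightarrow> sorted w \<longleftrightarrow> (\<forall>x y. x < y \<longrightarrow> \<not> before w y x)"
proof (induction w)
  case (Cons a w)
  then show ?case by (simp flip: not_less) blast
qed simp

text \<open>Knuth's criterion: an inversion \<open>y\<close>, \<open>x\<close> of the output,
  together with the larger letter between them in the input, is an occurrence of 231.\<close>

lemma sorted_stack_sort_iff:
  assumes "distinct w"
  shows "sorted (stack_sort w) \<longleftrightarrow> avoids_231 w"
proof -
  have "before (stack_sort w) y x \<longleftrightarrow> x \<in> set w \<and> y \<in> set w \<and> (\<exists>z>y. before w y z \<and> before w z x)" if "x < y" for x y
    using before_stack_sort[OF assms _ _ that] before_in_set[of "stack_sort w" y x] before_in_set[of w] set_stack_sort[OF assms]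
    by blast
  then show ?thesis
    unfolding sorted_iff_before[OF distinct_stack_sort[OF assms]] avoids_231_def
    using before_in_set[of w] by blast
qed

lemma stack_sort_eq_upt_iff:
  assumes "w \<in> permutations_of_set {1..n}"
  shows "stack_sort w = [1..<Suc n] \<longleftrightarrow> avoids_231 w"
proof -
  have w: "distinct w" "set w = {1..n}"
    using assms by (auto simp: permutations_of_set_def)
  have "sorted (stack_sort w) \<longleftrightarrow> stack_sort w = [1..<Suc n]"
  proof
    assume "sorted (stack_sort w)"
    moreover have "set (stack_sort w) = set [1..<Suc n]"
      using w set_stack_sort[of w] by auto
    ultimately show "stack_sort w = [1..<Suc n]"
      using w by (intro sorted_distinct_set_unique) (auto simp: distinct_stack_sort simp del: upt_Suc)
  qed (simp del: upt_Suc)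
  then show ?thesis
    using sorted_stack_sort_iff[OF w(1)] by simp
qed

lemma before_iff_nth: "before w x y \<longleftrightarrow> (\<exists>i j. i < j \<and> j < length w \<and> w ! i = x \<and> w ! j = y)"
proof (induction w)
  case (Cons a w)
  have "(\<exists>i j. i < j \<and> j < length (a # w) \<and> (a # w) ! i = x \<and> (a # w) ! j = y) \<longleftrightarrow>
     (\<exists>j<length w. a = x \<and> w ! j = y) \<or> (\<exists>i j. i < j \<and> j < length w \<and> w ! i = x \<and> w ! j = y)"
    (is "?l \<longleftrightarrow> ?r")
  proof
    assume ?l
    then obtain i j where ij: "i < j" "j < length (a # w)" "(a # w) ! i = x" "(a # w) ! j = y" by blast
    then obtain j' where j: "j = Suc j'" by (metis less_imp_Suc_add)
    show ?r
      using ij by (cases i) (auto simp: j)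
  next
    assume ?r
    then show ?l
    proof
      assume "\<exists>j<length w. a = x \<and> w ! j = y"
      then obtain j where "j < length w" "a = x" "w ! j = y" by blast
      then show ?l by (intro exI[of _ 0] exI[of _ "Suc j"]) auto
    next
      assume "\<exists>i j. i < j \<and> j < length w \<and> w ! i = x \<and> w ! j = y"
      then obtain i j where "i < j" "j < length w" "w ! i = x" "w ! j = y" by blast
      then show ?l by (intro exI[of _ "Suc i"] exI[of _ "Suc j"]) auto
    qed
  qed
  then show ?case
    by (simp add: Cons.IH in_set_conv_nth) blast
qed simp

context
  fixes w :: "nat list" and n :: nat
  assumes w: "w \<in> permutations_of_set {1..n}"
begin

lemma perm_facts: "distinct w" "set w = {1..n}" "length w = n"
  using w distinct_card[of w] by (auto simp: permutations_of_set_def)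

lemma bij_perm_of_word: "bij (perm_of_word w)"
  and perm_of_word_in: "i \<in> {1..n} \<Longrightarrow> perm_of_word w i \<in> {1..n}"
proof -
  have in_range: "perm_of_word w i \<in> {1..n}" if "i \<in> {1..n}" for i
    using that perm_facts nth_mem[of "i - 1" w] by (auto simp: perm_of_word_def)
  have "inj_on (perm_of_word w) {1..n}"
    using perm_facts by (auto simp: inj_on_def perm_of_word_def nth_eq_iff_index_eq)
  with in_range have "perm_of_word w ` {1..n} = {1..n}"
    by (intro endo_inj_surj) auto
  then have "bij_betw (perm_of_word w) {1..n} {1..n}"
    using \<open>inj_on _ _\<close> by (simp add: bij_betw_def)
  moreover have "bij_betw (perm_of_word w) (- {1..n}) (- {1..n})"
    by (rule bij_betw_cong[THEN iffD2, OF _ bij_betw_id]) (use perm_facts in \<open>auto simp: perm_of_word_def\<close>)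
  ultimately have "bij_betw (perm_of_word w) ({1..n} \<union> - {1..n}) ({1..n} \<union> - {1..n})"
    by (rule bij_betw_combine) auto
  then show "bij (perm_of_word w)" by simp
  show "i \<in> {1..n} \<Longrightarrow> perm_of_word w i \<in> {1..n}" by (rule in_range)
qed

lemma inverse_word_in_permutations: "inverse_word w \<in> permutations_of_set {1..n}"
proof -
  have "inv (perm_of_word w) i \<in> {1..n}" if "i \<in> {1..n}" for i
  proof (rule ccontr)
    assume *: "inv (perm_of_word w) i \<notin> {1..n}"
    then have "perm_of_word w (inv (perm_of_word w) i) = inv (perm_of_word w) i"
      using perm_facts by (auto simp: perm_of_word_def)
    moreover have "perm_of_word w (inv (perm_of_word w) i) = i"
      using bij_perm_of_word by (simp add: bij_is_surj surj_f_inv_f)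
    ultimately show False using that * by simp
  qed
  moreover have inj: "inj_on (inv (perm_of_word w)) {1..n}"
    using bij_perm_of_word bij_imp_bij_inv bij_is_inj inj_on_subset subset_UNIV by metis
  ultimately have "inv (perm_of_word w) ` {1..n} = {1..n}"
    by (intro endo_inj_surj) auto
  moreover have "set [1..<Suc n] = {1..n}" by auto
  ultimately show ?thesis
    using inj by (simp add: inverse_word_def permutations_of_set_def perm_facts distinct_map del: upt_Suc)
qed

lemma before_inverse_word:
  assumes "i \<in> {1..n}" "j \<in> {1..n}"
  shows "before (inverse_word w) (inv (perm_of_word w) i) (inv (perm_of_word w) j) \<longleftrightarrow> i < j"
proof -
  let ?v = "inverse_word w"
  have v: "distinct ?v" "length ?v = n"
    using inverse_word_in_permutations by (auto simp: permutations_of_set_def inverse_word_def perm_facts)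
  have nth: "inv (perm_of_word w) i = ?v ! (i - 1)" if "i \<in> {1..n}" for i
    using that unfolding inverse_word_def perm_facts by (subst nth_map) (auto simp del: upt_Suc)
  show ?thesis
  proof
    assume "i < j"
    then show "before ?v (inv (perm_of_word w) i) (inv (perm_of_word w) j)"
      using assms v unfolding before_iff_nth nth[OF assms(1)] nth[OF assms(2)]
      by (intro exI[of _ "i - 1"] exI[of _ "j - 1"]) auto
  next
    assume "before ?v (inv (perm_of_word w) i) (inv (perm_of_word w) j)"
    then obtain k l where kl: "k < l" "l < n" "?v ! k = ?v ! (i - 1)" "?v ! l = ?v ! (j - 1)"
      using v unfolding before_iff_nth nth[OF assms(1)] nth[OF assms(2)] by auto
    then have "k = i - 1" "l = j - 1"
      using v assms by (auto simp: nth_eq_iff_index_eq)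
    then show "i < j" using kl assms by auto
  qed
qed

lemma before_perm_of_word:
  assumes "i \<in> {1..n}" "j \<in> {1..n}"
  shows "before w (perm_of_word w i) (perm_of_word w j) \<longleftrightarrow> i < j"
proof -
  have nth: "perm_of_word w i = w ! (i - 1)" if "i \<in> {1..n}" for i
    using that by (simp add: perm_of_word_def perm_facts)
  show ?thesis
  proof
    assume "i < j"
    then show "before w (perm_of_word w i) (perm_of_word w j)"
      using assms perm_facts unfolding before_iff_nth nth[OF assms(1)] nth[OF assms(2)]
      by (intro exI[of _ "i - 1"] exI[of _ "j - 1"]) auto
  next
    assume "before w (perm_of_word w i) (perm_of_word w j)"
    then obtain k l where kl: "k < l" "l < n" "w ! k = w ! (i - 1)" "w ! l = w ! (j - 1)"
      using perm_facts unfolding before_iff_nth nth[OF assms(1)] nth[OF assms(2)] by auto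
    then have "k = i - 1" "l = j - 1"
      using perm_facts assms by (auto simp: nth_eq_iff_index_eq)
    then show "i < j" using kl assms by auto
  qed
qed

text \<open>Inversion exchanges positions and values: precedence in one word is the order of values
  in the other, and 312 is the inverse of 231.\<close>

lemma avoids_231_inverse_word: "avoids_231 (inverse_word w) \<longleftrightarrow> avoids_312 w"
proof -
  let ?f = "perm_of_word w" and ?g = "inv (perm_of_word w)"
  have fg: "?f (?g i) = i" and gf: "?g (?f i) = i" for i
    using bij_perm_of_word by (simp_all add: bij_is_surj surj_f_inv_f bij_is_inj)
  have g_in: "?g i \<in> {1..n}" if "i \<in> {1..n}" for i
    using inverse_word_in_permutations that
    by (auto simp: inverse_word_def permutations_of_set_def perm_facts simp del: upt_Suc)
  have set: "set (inverse_word w) = {1..n}"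
    using inverse_word_in_permutations by (simp add: permutations_of_set_def)
  have b1: "before (inverse_word w) x y \<longleftrightarrow> x \<in> {1..n} \<and> y \<in> {1..n} \<and> ?f x < ?f y" for x y
  proof (cases "x \<in> {1..n} \<and> y \<in> {1..n}")
    case True
    then show ?thesis
      using before_inverse_word[OF perm_of_word_in perm_of_word_in, of x y] unfolding gf by blast
  next
    case False
    then show ?thesis
      using before_in_set[of "inverse_word w" x y] unfolding set by blast
  qed
  have b2: "before w x y \<longleftrightarrow> x \<in> {1..n} \<and> y \<in> {1..n} \<and> ?g x < ?g y" for x y
  proof (cases "x \<in> {1..n} \<and> y \<in> {1..n}")
    case True
    then show ?thesis
      using before_perm_of_word[OF g_in g_in, of x y] unfolding fg by blast
  next
    case False
    then show ?thesis
      using before_in_set[of w x y] unfolding perm_facts by blast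
  qed
  show ?thesis
  proof
    assume L: "avoids_231 (inverse_word w)"
    show "avoids_312 w"
      unfolding avoids_312_def
    proof
      assume "\<exists>a b c. a < b \<and> b < c \<and> before w c a \<and> before w a b"
      then obtain a b c where *: "a < b" "b < c" "before w c a" "before w a b" by blast
      then have "?g c < ?g a" "?g a < ?g b" "?g a \<in> {1..n}" "?g b \<in> {1..n}" "?g c \<in> {1..n}"
        unfolding b2 using g_in by blast+
      moreover from this have "before (inverse_word w) (?g a) (?g b)" "before (inverse_word w) (?g b) (?g c)"
        unfolding b1 fg using * by blast+
      ultimately show False
        using L unfolding avoids_231_def by blast
    qed
  next
    assume L: "avoids_312 w"
    show "avoids_231 (inverse_word w)"
      unfolding avoids_231_def
    proof
      assume "\<exists>a b c. a < b \<and> b < c \<and> before (inverse_word w) b c \<and> before (inverse_word w) c a"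
      then obtain a b c where *: "a < b" "b < c" "before (inverse_word w) b c" "before (inverse_word w) c a" by blast
      then have "?f b < ?f c" "?f c < ?f a" "?f a \<in> {1..n}" "?f b \<in> {1..n}" "?f c \<in> {1..n}"
        unfolding b1 using perm_of_word_in by blast+
      moreover from this have "before w (?f a) (?f b)" "before w (?f b) (?f c)"
        unfolding b2 gf using * by blast+
      ultimately show False
        using L unfolding avoids_312_def by blast
    qed
  qed
qed

end

text \<open>Let \<open>c a b\<close> form 312 in the output. That \<open>c\<close> precedes
  \<open>a\<close> means that the input has \<open>c z a\<close> with \<open>z > c\<close>, a 341.
  That \<open>a\<close> precedes \<open>b\<close> means that no letter larger than \<open>b\<close>
  stands between \<open>b\<close> and \<open>a\<close> in this order. So \<open>b\<close> follows
  \<open>a\<close>, giving 3412, or precedes it with only smaller letters in between, giving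
  3-4-21.\<close>

lemma avoids_312_stack_sort_iff:
  assumes "distinct w"
  shows "avoids_312 (stack_sort w) \<longleftrightarrow> sis_avoids w"
proof -
  have S: "before (stack_sort w) y x \<longleftrightarrow> (\<exists>z>y. before w y z \<and> before w z x)"
    if "x < y" "x \<in> set w" "y \<in> set w" for x y
    using before_stack_sort[OF assms that(2,3,1)] .
  have S': "before (stack_sort w) x y \<longleftrightarrow> \<not> (\<exists>z>y. before w y z \<and> before w z x)"
    if "x < y" "x \<in> set w" "y \<in> set w" for x y
    using S[OF that] that before_total[of x "stack_sort w" y] before_asym[of "stack_sort w" x y]
      set_stack_sort[OF assms] distinct_stack_sort[OF assms] by auto
  show ?thesis
  proof
    assume L: "avoids_312 (stack_sort w)"
    show "sis_avoids w"
      unfolding sis_avoids_def sis_split_def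
    proof (intro allI impI ballI)
      fix u a v c x
      assume e: "w = u @ a # v" and c: "c \<in> ascent_bottoms u" and x: "x \<in> insert (last u) (set v)"
      show "\<not> (a < x \<and> x < c)"
      proof
        assume ax: "a < x \<and> x < c"
        from c obtain z where z: "before u c z" "c < z" by (auto simp: ascent_bottoms_def)
        then have cz: "c \<in> set u" "z \<in> set u" by (auto dest: before_in_set)
        then have "u \<noteq> []" by auto
        then have inw: "a \<in> set w" "x \<in> set w" "c \<in> set w" using x cz by (auto simp: e)
        have "before w c z" "before w z a" using z cz by (auto simp: e before_append)
        then have "before (stack_sort w) c a"
          using S[of a c] z(2) ax inw by auto
        moreover have "before (stack_sort w) a x"
        proof -
          \<comment> \<open>The letter \<open>x\<close> comes after \<open>a\<close> or immediately
            before it, so no letter can lie between them in that order.\<close>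
          have "\<not> (before w x y \<and> before w y a)" for y
          proof (cases "x \<in> set v")
            case True
            then show ?thesis
              using assms by (auto simp: e before_append dest: before_in_set)
          next
            case False
            then have "x = last u" using x by simp
            then obtain u' where u: "u = u' @ [x]"
              using \<open>u \<noteq> []\<close> by (metis append_butlast_last_id)
            show ?thesis
              using assms by (auto simp: e u before_append dest: before_in_set)
          qed
          then show ?thesis
            using S'[of a x] ax inw by auto
        qed
        ultimately show False
          using L ax unfolding avoids_312_def by blast
      qed
    qed
  next
    assume L: "sis_avoids w"
    show "avoids_312 (stack_sort w)"
      unfolding avoids_312_def
    proof
      assume "\<exists>a b c. a < b \<and> b < c \<and> before (stack_sort w) c a \<and> before (stack_sort w) a b"
      then obtain a b c where abc: "a < b" "b < c" "before (stack_sort w) c a" "before (stack_sort w) a b" by blast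
      then have inw: "a \<in> set w" "b \<in> set w" "c \<in> set w"
        using before_in_set[of "stack_sort w"] set_stack_sort[OF assms] by blast+
      have "a < c" using abc by simp
      then obtain z where z: "c < z" "before w c z" "before w z a"
        using S[of a c] abc(3) inw by blast
      have nb: "\<not> (before w b y \<and> before w y a)" if "y > b" for y
        using S'[of a b] abc inw that by auto
      obtain U V where w: "w = U @ a # V"
        using inw(1) by (meson split_list)
      have d: "distinct U" "a \<notin> set U" "a \<notin> set V" "set U \<inter> set V = {}"
        using assms w by auto
      have bw: "before w x a \<longleftrightarrow> x \<in> set U" for x
        using d by (auto simp: w before_append dest: before_in_set)
      have zU: "z \<in> set U" using z bw by blast
      have cU: "before U c z"
        using z(2) zU d by (auto simp: w before_append dest: before_in_set)
      show False
      proof (cases "b \<in> set V")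
        case True
        have "c \<in> ascent_bottoms U" using cU z(1) by (auto simp: ascent_bottoms_def)
        then show False
          using L abc True unfolding sis_avoids_def sis_split_def w by blast
      next
        case False
        then have "b \<in> set U" using inw abc by (auto simp: w)
        then obtain U1 U2 where U: "U = U1 @ b # U2"
          by (meson split_list)
        \<comment> \<open>A larger letter here would push \<open>b\<close> out before
          \<open>a\<close>. Hence \<open>c\<close> and \<open>z\<close> stand left of
          \<open>b\<close>, and the letter right after \<open>b\<close>, whether \<open>a\<close>
          itself or the head of \<open>U2\<close>, can play the 1 next to \<open>b\<close> as the
          2.\<close>
        have small: "y < b" if "y \<in> set U2" for y
        proof -
          have "before w b y" "before w y a"
            using that by (auto simp: w U before_append)
          then have "\<not> y > b" using nb by blast
          moreover have "y \<noteq> b" using that d by (auto simp: U)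
          ultimately show ?thesis by simp
        qed
        have "z \<notin> set U2" "c \<notin> set U2" using small z abc by fastforce+
        then have "before (U1 @ [b]) c z"
          using cU z abc by (auto simp: U before_append dest: before_in_set)
        then have cb: "c \<in> ascent_bottoms (U1 @ [b])"
          using z(1) by (auto simp: ascent_bottoms_def)
        show False
        proof (cases U2)
          case Nil
          then show False
            using L cb abc unfolding sis_avoids_def sis_split_def w U by (metis append.assoc insertI1 last_snoc)
        next
          case (Cons a' U3)
          then have "w = (U1 @ [b]) @ a' # (U3 @ a # V)" "a' < b"
            using small by (auto simp: w U)
          then show False
            using L cb abc unfolding sis_avoids_def sis_split_def by (metis insertI1 last_snoc)
        qed
      qed
    qed
  qed
qed

lemma sis_sorted_iff:
  assumes "\<sigma> \<in> permutations_of_set {1..n}"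
  shows "stack_sort (inverse_word (stack_sort \<sigma>)) = [1..<Suc n] \<longleftrightarrow> sis_avoids \<sigma>"
proof -
  have \<sigma>: "distinct \<sigma>" "stack_sort \<sigma> \<in> permutations_of_set {1..n}"
    using assms by (simp_all add: permutations_of_set_def set_stack_sort distinct_stack_sort)
  show ?thesis
    unfolding stack_sort_eq_upt_iff[OF inverse_word_in_permutations[OF \<sigma>(2)]]
      avoids_231_inverse_word[OF \<sigma>(2)] avoids_312_stack_sort_iff[OF \<sigma>(1)] ..
qed

lemma bax_avoids_iff: "bax_avoids w \<longleftrightarrow> \<not> contains_2_41_3 w \<and> \<not> contains_3_14_2 w"
proof -
  have "\<not> bax_avoids w" if "i < j" "j + 1 < k" "k < length w"
    "w ! (j + 1) < w ! i \<and> w ! i < w ! k \<and> w ! k < w ! j \<or> w ! j < w ! k \<and> w ! k < w ! i \<and> w ! i < w ! (j + 1)"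
    for i j k
  proof
    assume "bax_avoids w"
    moreover have "w = take j w @ w ! j # w ! (j + 1) # drop (j + 2) w"
      using that(2,3) by (simp add: Cons_nth_drop_Suc)
    ultimately have av: "bax_avoids (take j w @ w ! j # w ! (j + 1) # drop (j + 2) w)"
      by simp
    from that(2) obtain l where k: "k = j + 2 + l"
      using le_Suc_ex[of "j + 2" k] by auto
    have "take j w ! i \<in> set (take j w)" "drop (j + 2) w ! l \<in> set (drop (j + 2) w)"
      by (rule nth_mem; use that k in simp)+
    then have "w ! i \<in> set (take j w)" "w ! k \<in> set (drop (j + 2) w)"
      using that(1,3) by (simp_all add: k)
    from bax_avoidsD[OF av this] show False
      using that(4) by blast
  qed
  moreover have "contains_2_41_3 w \<or> contains_3_14_2 w" if "\<not> bax_avoids w"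
  proof -
    from that obtain u x y v s t where w: "w = u @ x # y # v" and st: "s \<in> set u" "t \<in> set v"
      and ord: "y < s \<and> s < t \<and> t < x \<or> x < t \<and> t < s \<and> s < y"
      unfolding bax_avoids_def by blast
    from st obtain i l where il: "i < length u" "u ! i = s" "l < length v" "v ! l = t"
      by (meson in_set_conv_nth)
    define j k where "j = length u" and "k = length u + 2 + l"
    have "w ! i = s" "w ! j = x" "w ! (j + 1) = y" "w ! k = t"
      using il by (simp_all add: w j_def k_def nth_append)
    moreover have "i < j" "j + 1 < k" "k < length w"
      using il by (simp_all add: w j_def k_def)
    ultimately show ?thesis
      using ord unfolding contains_2_41_3_def contains_3_14_2_def by metis
  qed
  ultimately show ?thesis
    unfolding contains_2_41_3_def contains_3_14_2_def by blast
qed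

theorem theorem1p3:
  fixes n :: nat
  assumes "n \<ge> 1"
  shows "real (card {\<sigma> \<in> permutations_of_set {1..n}.
            stack_sort (inverse_word (stack_sort \<sigma>)) = [1..<Suc n]}) = baxter_number n \<and>
         card {\<sigma> \<in> permutations_of_set {1..n}.
            stack_sort (inverse_word (stack_sort \<sigma>)) = [1..<Suc n]} =
         card {\<sigma> \<in> permutations_of_set {1..n}. \<not> contains_2_41_3 \<sigma> \<and> \<not> contains_3_14_2 \<sigma>}"
proof -
  obtain m where n: "n = Suc m"
    using assms by (cases n) auto
  have "{\<sigma> \<in> permutations_of_set {1..n}. stack_sort (inverse_word (stack_sort \<sigma>)) = [1..<Suc n]} =
      {\<sigma> \<in> permutations_of_set {1..n}. sis_avoids \<sigma>}"
    using sis_sorted_iff by blast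
  moreover have "real (card {\<sigma> \<in> permutations_of_set {1..n}. sis_avoids \<sigma>}) = baxter_number n"
    unfolding n card_sis_avoids bax_total_eq_baxter_number ..
  moreover have "real (card {\<sigma> \<in> permutations_of_set {1..n}. \<not> contains_2_41_3 \<sigma> \<and> \<not> contains_3_14_2 \<sigma>}) = baxter_number n"
    using card_bax_avoids[of m] unfolding n bax_avoids_iff bax_total_eq_baxter_number .
  ultimately show ?thesis
    by (metis of_nat_eq_iff)
qed

end
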